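(* Let $d \geq 2$ be an integer and let $(f_n)_{n \geq 0}$ be any sequence of elements of $\mathrm{Poly}_d(\mathbb{C})$ that degenerates in $\mathcal{P}_d(\mathbb{C})$. Then $$\lim_{n \to +\infty} \max\left\{ M_{f_n}^{(1)}, M_{f_n}^{(2)} \right\} = +\infty .$$ Furthermore, if $d \in \{2,3\}$, then $\lim_{n \to +\infty} M_{f_n}^{(1)} = +\infty$.
   Context: $\mathrm{Poly}_d(\mathbb{C})$ is the set of complex polynomials of degree $d$ (topologized by their coefficients, as $\mathbb{C}^d \times \mathbb{C}^*$). The group $\mathrm{Aff}(\mathbb{C})$ of complex affine transformations acts on it by conjugation, $\phi \cdot f = \phi \circ f \circ \phi^{-1}$, and $\mathcal{P}_d(\mathbb{C}) = \mathrm{Poly}_d(\mathbb{C})/\mathrm{Aff}(\mathbb{C})$ with the quotient topology; $[f]$ is the class of $f$. A sequence $(f_n)_{n \geq 0}$ in $\mathrm{Poly}_d(\mathbb{C})$ degenerates in $\mathcal{P}_d(\mathbb{C})$ if, for every compact subset $E$ of $\mathcal{P}_d(\mathbb{C})$, $[f_n] \notin E$ for all sufficiently large $n$. For $f \in \mathrm{Poly}_d(\mathbb{C})$, the dynatomic polynomials $\Phi_f^{(p)}$ ($p \geq 1$) are the unique polynomials with $f^{\circ p}(z) - z = \prod_{k \mid p} \Phi_f^{(k)}(z)$ for all $p \geq 1$. There is a unique monic polynomial $\chi_f^{(p)}(\lambda)$ such that $\chi_f^{(p)}(\lambda)^p = \prod_{z} (\lambda - (f^{\circ p})'(z))$, the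 product being over the roots $z$ of $\Phi_f^{(p)}$ counted with multiplicity. $\Lambda_f^{(p)}$ is the multiset of roots of $\chi_f^{(p)}$ (generically, the multipliers of $f$ at its cycles with period $p$), and $M_f^{(p)} = \max_{\lambda \in \Lambda_f^{(p)}} \frac{1}{p} \log|\lambda|$ (with $\log 0 = -\infty$). *)

theory Defs
  imports "HOL-Analysis.Analysis" "HOL-Computational_Algebra.Computational_Algebra"
begin

definition Poly_deg :: "nat \<Rightarrow> complex poly set"
  where "Poly_deg d = {f. degree f = d}"

text \<open>
  The coefficients of index greater than \<open>d\<close> vanish on \<open>Poly_deg d\<close> and the coefficient of
  index \<open>d\<close> does not (for \<open>d > 0\<close>), so the initial topology for the coefficient map into the
  product space \<open>nat \<Rightarrow> complex\<close> is the topology of \<open>\<complex>\<^sup>d \<times> \<complex>\<^sup>*\<close>.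
\<close>
definition Poly_top :: "nat \<Rightarrow> complex poly topology"
  where "Poly_top d = pullback_topology (Poly_deg d) coeff euclidean"

text \<open>\<open>\<phi> \<circ> f \<circ> \<phi>\<^sup>-\<^sup>1\<close> for the affine map \<open>\<phi> z = a * z + b\<close>, where \<open>a \<noteq> 0\<close>.\<close>
definition aff_conj :: "complex \<Rightarrow> complex \<Rightarrow> complex poly \<Rightarrow> complex poly"
  where "aff_conj a b f = pcompose [:b, a:] (pcompose f [:- b / a, 1 / a:])"

definition aff_class :: "complex poly \<Rightarrow> complex poly set"
  where "aff_class f = {aff_conj a b f | a b. a \<noteq> 0}"

definition Moduli :: "nat \<Rightarrow> complex poly set set"
  where "Moduli d = aff_class ` Poly_deg d"

definition Moduli_top :: "nat \<Rightarrow> complex poly set topology"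
  where "Moduli_top d = topology (\<lambda>U. U \<subseteq> Moduli d \<and>
           openin (Poly_top d) {f \<in> Poly_deg d. aff_class f \<in> U})"

definition degenerates :: "nat \<Rightarrow> (nat \<Rightarrow> complex poly) \<Rightarrow> bool"
  where "degenerates d f \<longleftrightarrow>
           (\<forall>E. compactin (Moduli_top d) E \<longrightarrow> (\<forall>\<^sub>F n in sequentially. aff_class (f n) \<notin> E))"

definition iter_poly :: "complex poly \<Rightarrow> nat \<Rightarrow> complex poly"
  where "iter_poly f p = (pcompose f ^^ p) [:0, 1:]"

text \<open>
  The polynomial of index \<open>p\<close> is already determined by the product formulas for the divisors
  \<open>m\<close> of \<open>p\<close>; see \<open>dynatomic_eq\<close> below for the agreement with a family satisfying all of them.
\<close>
definition dynatomic :: "complex poly \<Rightarrow> nat \<Rightarrow> complex poly"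
  where "dynatomic f p = (THE q. \<exists>\<Phi>. \<Phi> p = q \<and>
           (\<forall>m. m dvd p \<longrightarrow> iter_poly f m - [:0, 1:] = (\<Prod>k | k dvd m. \<Phi> k)))"

definition multiplier_poly :: "complex poly \<Rightarrow> nat \<Rightarrow> complex poly"
  where "multiplier_poly f p = (THE q. lead_coeff q = 1 \<and>
           q ^ p = (\<Prod>z\<in>#proots (dynatomic f p). [:- poly (pderiv (iter_poly f p)) z, 1:]))"

definition multipliers :: "complex poly \<Rightarrow> nat \<Rightarrow> complex multiset"
  where "multipliers f p = proots (multiplier_poly f p)"

definition log_abs :: "complex \<Rightarrow> ereal"
  where "log_abs z = (if z = 0 then - \<infinity> else ereal (ln (cmod z)))"

definition max_log_multiplier :: "complex poly \<Rightarrow> nat \<Rightarrow> ereal"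
  where "max_log_multiplier f p =
           Max ((\<lambda>l. ereal (1 / real p) * log_abs l) ` set_mset (multipliers f p))"

lemma topspace_Poly_top [simp]: "topspace (Poly_top d) = Poly_deg d"
  by (simp add: Poly_top_def topspace_pullback_topology)

lemma openin_Moduli_top:
  "openin (Moduli_top d) U \<longleftrightarrow>
     U \<subseteq> Moduli d \<and> openin (Poly_top d) {f \<in> Poly_deg d. aff_class f \<in> U}"
proof -
  have "istopology (\<lambda>U. U \<subseteq> Moduli d \<and> openin (Poly_top d) {f \<in> Poly_deg d. aff_class f \<in> U})"
    unfolding istopology_def
  proof (intro conjI allI impI; (elim conjE)?)
    fix S T
    assume "openin (Poly_top d) {f \<in> Poly_deg d. aff_class f \<in> S}"
           "openin (Poly_top d) {f \<in> Poly_deg d. aff_class f \<in> T}"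
    then have "openin (Poly_top d)
        ({f \<in> Poly_deg d. aff_class f \<in> S} \<inter> {f \<in> Poly_deg d. aff_class f \<in> T})"
      by (rule openin_Int)
    moreover have "{f \<in> Poly_deg d. aff_class f \<in> S} \<inter> {f \<in> Poly_deg d. aff_class f \<in> T}
        = {f \<in> Poly_deg d. aff_class f \<in> S \<inter> T}"
      by auto
    ultimately show "openin (Poly_top d) {f \<in> Poly_deg d. aff_class f \<in> S \<inter> T}"
      by simp
  next
    fix K
    assume K: "\<forall>U\<in>K. U \<subseteq> Moduli d \<and> openin (Poly_top d) {f \<in> Poly_deg d. aff_class f \<in> U}"
    have "{f \<in> Poly_deg d. aff_class f \<in> \<Union>K} = (\<Union>U\<in>K. {f \<in> Poly_deg d. aff_class f \<in> U})"
      by auto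
    then show "openin (Poly_top d) {f \<in> Poly_deg d. aff_class f \<in> \<Union>K}"
      using K by auto
  qed auto
  then show ?thesis
    by (simp add: Moduli_top_def topology_inverse')
qed

lemma topspace_Moduli_top [simp]: "topspace (Moduli_top d) = Moduli d"
proof
  show "topspace (Moduli_top d) \<subseteq> Moduli d"
    using openin_Moduli_top openin_topspace by blast
  have "openin (Poly_top d) {f \<in> Poly_deg d. aff_class f \<in> Moduli d}"
    using openin_topspace[of "Poly_top d"] by (simp add: Moduli_def Collect_conj_eq Int_absorb2 subset_iff)
  then show "Moduli d \<subseteq> topspace (Moduli_top d)"
    by (intro openin_subset) (simp add: openin_Moduli_top)
qed

lemma quotient_map_aff_class: "quotient_map (Poly_top d) (Moduli_top d) aff_class"
  by (auto simp: quotient_map_def openin_Moduli_top) (auto simp: Moduli_def)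

lemma aff_conj_aff_conj:
  assumes "a \<noteq> 0" "c \<noteq> 0"
  shows "aff_conj c e (aff_conj a b f) = aff_conj (c * a) (c * b + e) f"
proof -
  have "poly (aff_conj c e (aff_conj a b f)) z = poly (aff_conj (c * a) (c * b + e) f) z" for z
  proof -
    have arg: "- b / a + (- e / c + z * (1 / c)) * (1 / a)
        = - (c * b + e) / (c * a) + z * (1 / (c * a))"
      using assms by (simp add: field_simps)
    have "poly (aff_conj c e (aff_conj a b f)) z
        = e + c * (b + a * poly f (- b / a + (- e / c + z * (1 / c)) * (1 / a)))"
      by (simp add: aff_conj_def poly_pcompose mult.commute)
    also have "\<dots> = poly (aff_conj (c * a) (c * b + e) f) z"
      unfolding arg by (simp add: aff_conj_def poly_pcompose algebra_simps)
    finally show ?thesis .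
  qed
  then show ?thesis by (metis poly_eq_poly_eq_iff ext)
qed

lemma aff_conj_1_0 [simp]: "aff_conj 1 0 f = f"
  by (simp add: aff_conj_def pcompose_idR pcompose_pCons)

lemma aff_class_eq_iff: "aff_class f = aff_class g \<longleftrightarrow> (\<exists>a b. a \<noteq> 0 \<and> g = aff_conj a b f)"
proof
  assume "aff_class f = aff_class g"
  moreover have "g \<in> aff_class g"
    unfolding aff_class_def by (rule CollectI, rule exI[of _ 1], rule exI[of _ 0]) simp
  ultimately have "g \<in> aff_class f" by simp
  then show "\<exists>a b. a \<noteq> 0 \<and> g = aff_conj a b f"
    unfolding aff_class_def by blast
next
  assume "\<exists>a b. a \<noteq> 0 \<and> g = aff_conj a b f"
  then obtain a b where a: "a \<noteq> 0" and g: "g = aff_conj a b f" by blast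
  have f: "f = aff_conj (1 / a) (- b / a) g"
    using a by (simp add: g aff_conj_aff_conj)
  show "aff_class f = aff_class g"
  proof
    show "aff_class g \<subseteq> aff_class f"
      using a by (auto simp: aff_class_def g aff_conj_aff_conj) (metis mult_eq_0_iff)
    show "aff_class f \<subseteq> aff_class g"
    proof
      fix h assume "h \<in> aff_class f"
      then obtain c e where c: "c \<noteq> 0" "h = aff_conj c e f" by (auto simp: aff_class_def)
      then have "h = aff_conj (c * (1 / a)) (c * (- b / a) + e) g"
        using a by (subst (asm) f) (simp add: aff_conj_aff_conj)
      moreover have "c * (1 / a) \<noteq> 0" using a c by simp
      ultimately show "h \<in> aff_class g" unfolding aff_class_def by blast
    qed
  qed
qed

lemma degree_iter_poly: "degree (iter_poly f p) = degree f ^ p"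
  by (induction p) (simp_all add: iter_poly_def degree_pcompose)

lemma poly_iter_poly: "poly (iter_poly f p) z = (poly f ^^ p) z"
  by (induction p) (simp_all add: iter_poly_def poly_pcompose)

lemma iter_poly_minus_id_nonzero:
  assumes "degree f \<ge> 2" "p \<ge> 1"
  shows "iter_poly f p - [:0, 1:] \<noteq> 0"
proof
  assume "iter_poly f p - [:0, 1:] = 0"
  then have "degree f ^ p = 1"
    by (metis degree_iter_poly degree_pCons_eq_if degree_pCons_0 eq_iff_diff_eq_0 one_neq_zero
        pCons_eq_0_iff One_nat_def)
  then show False using assms by (simp add: power_eq_1_iff)
qed

lemma dynatomic_family_unique:
  fixes \<Phi> \<Psi> :: "nat \<Rightarrow> complex poly"
  assumes f: "degree f \<ge> 2" and p: "p \<ge> 1"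
    and \<Phi>: "\<And>m. m dvd p \<Longrightarrow> iter_poly f m - [:0, 1:] = (\<Prod>k | k dvd m. \<Phi> k)"
    and \<Psi>: "\<And>m. m dvd p \<Longrightarrow> iter_poly f m - [:0, 1:] = (\<Prod>k | k dvd m. \<Psi> k)"
  shows "\<Phi> p = \<Psi> p"
proof -
  have "m dvd p \<Longrightarrow> \<Phi> m = \<Psi> m" for m
  proof (induction m rule: less_induct)
    case (less m)
    have m: "m \<ge> 1" using less.prems p by (cases m) auto
    have D: "{k. k dvd m} = insert m {k. k dvd m \<and> k < m}" "finite {k. k dvd m \<and> k < m}"
      using m by (auto dest: dvd_imp_le intro: le_neq_implies_less)
    have eq: "(\<Prod>k | k dvd m \<and> k < m. \<Phi> k) = (\<Prod>k | k dvd m \<and> k < m. \<Psi> k)"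
      using less by (intro prod.cong) (auto intro: dvd_trans)
    have "\<Phi> m * (\<Prod>k | k dvd m \<and> k < m. \<Phi> k) = iter_poly f m - [:0, 1:]"
      using \<Phi>[OF less.prems] D by simp
    moreover have "\<Psi> m * (\<Prod>k | k dvd m \<and> k < m. \<Phi> k) = iter_poly f m - [:0, 1:]"
      using \<Psi>[OF less.prems] D eq by simp
    moreover have "(\<Prod>k | k dvd m \<and> k < m. \<Phi> k) \<noteq> 0"
      using iter_poly_minus_id_nonzero[OF f m] calculation by (metis mult_zero_right)
    ultimately show ?case by (metis mult_right_cancel)
  qed
  then show ?thesis by simp
qed

lemma dynatomic_eq_local:
  fixes \<Phi> :: "nat \<Rightarrow> complex poly"
  assumes "degree f \<ge> 2" "p \<ge> 1"
    and "\<And>m. m dvd p \<Longrightarrow> iter_poly f m - [:0, 1:] = (\<Prod>k | k dvd m. \<Phi> k)"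
  shows "dynatomic f p = \<Phi> p"
  unfolding dynatomic_def
proof (rule the_equality)
  show "\<exists>\<Psi>. \<Psi> p = \<Phi> p \<and>
      (\<forall>m. m dvd p \<longrightarrow> iter_poly f m - [:0, 1:] = (\<Prod>k | k dvd m. \<Psi> k))"
    using assms(3) by blast
qed (use dynatomic_family_unique[OF assms(1,2)] assms(3) in metis)

lemma dynatomic_eq:
  fixes \<Phi> :: "nat \<Rightarrow> complex poly"
  assumes "degree f \<ge> 2" "p \<ge> 1"
    and "\<And>m. m \<ge> 1 \<Longrightarrow> iter_poly f m - [:0, 1:] = (\<Prod>k | k dvd m. \<Phi> k)"
  shows "dynatomic f p = \<Phi> p"
proof (rule dynatomic_eq_local[OF assms(1,2)])
  fix m assume "m dvd p"
  then have "m \<ge> 1" using assms(2) by (cases m) auto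
  then show "iter_poly f m - [:0, 1:] = (\<Prod>k | k dvd m. \<Phi> k)" by (rule assms(3))
qed

lemma monic_power_unique:
  fixes q r :: "complex poly"
  assumes "p \<ge> 1" "lead_coeff q = 1" "lead_coeff r = 1" "q ^ p = r ^ p"
  shows "q = r"
proof -
  have nz: "q \<noteq> 0" "r \<noteq> 0" using assms by auto
  have "order z (u ^ n) = n * order z u" if "u \<noteq> 0" for z n and u :: "complex poly"
    using that by (induction n) (simp_all add: order_mult)
  then have "p * order z q = p * order z r" for z
    using assms(4) nz by metis
  then have "proots q = proots r"
    using assms(1) nz by (intro multiset_eqI) simp
  then show ?thesis
    using assms complex_poly_decompose_multiset[of q] complex_poly_decompose_multiset[of r] by simp
qed

lemma multiplier_poly_eq:
  assumes "p \<ge> 1" "lead_coeff q = 1"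
    and "q ^ p = (\<Prod>z\<in>#proots (dynatomic f p). [:- poly (pderiv (iter_poly f p)) z, 1:])"
  shows "multiplier_poly f p = q"
  unfolding multiplier_poly_def
  by (rule the_equality) (use assms monic_power_unique in auto)

end

theory Submission
  imports Defs "HOL-Complex_Analysis.Great_Picard"
begin

text \<open>
  Suppose that the multipliers at the periods \<open>1\<close> and \<open>2\<close> stay bounded. Move two fixed points that
  are far apart (relative to the leading coefficient) to \<open>0\<close> and \<open>1\<close>, so that the leading coefficient
  of \<open>g n = z + P n z\<close> tends to infinity. Rescale \<open>P n\<close> around \<open>0\<close> and around \<open>1\<close> by factors
  \<open>\<rho> n, \<sigma> n \<longlonglongrightarrow> 0\<close> that make the largest coefficient have modulus \<open>1\<close>, and pass to nonconstant limits \<open>H\<close>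
  and \<open>K\<close>. Since the multipliers at the fixed points are bounded, all roots of \<open>H\<close> and \<open>K\<close> are
  multiple. Counting critical points, \<open>H = 1\<close> and \<open>K = -1\<close> then have simple solutions, and these are
  limits of \<open>2\<close>-cycles jumping between \<open>0\<close> and \<open>1\<close>, whose multipliers grow like \<open>1 / (\<rho> n * \<sigma> n)\<close>.
  In degree \<open>2\<close> and \<open>3\<close> the derivatives of \<open>g n\<close> at the fixed points \<open>0\<close> and \<open>1\<close> already control the
  leading coefficient.
\<close>

section \<open>Coefficientwise convergence of polynomials\<close>

text \<open>The common degree bound keeps everything in one finite-dimensional space;
  coefficientwise convergence alone would also send \<open>z ^ n\<close> to
  \<open>0\<close>.\<close>

definition poly_tendsto :: "(nat \<Rightarrow> complex poly) \<Rightarrow> complex poly \<Rightarrow> bool"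
  where "poly_tendsto p q \<longleftrightarrow>
           (\<exists>D. \<forall>n. degree (p n) \<le> D) \<and> (\<forall>i. (\<lambda>n. coeff (p n) i) \<longlonglongrightarrow> coeff q i)"

lemma poly_tendsto_coeff: "poly_tendsto p q \<Longrightarrow> (\<lambda>n. coeff (p n) i) \<longlonglongrightarrow> coeff q i"
  by (simp add: poly_tendsto_def)

lemma poly_tendsto_degreeE:
  assumes "poly_tendsto p q"
  obtains D where "\<And>n. degree (p n) \<le> D" "degree q \<le> D"
proof -
  obtain D where D: "\<And>n. degree (p n) \<le> D"
    using assms by (auto simp: poly_tendsto_def)
  have "coeff q i = 0" if "i > D" for i
  proof -
    have "coeff (p n) i = 0" for n
      using D[of n] that by (intro coeff_eq_0) linarith
    then show ?thesis
      using poly_tendsto_coeff[OF assms, of i] LIMSEQ_unique[OF _ tendsto_const] by simp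
  qed
  then show thesis
    using D that by (metis degree_le)
qed

lemma poly_tendsto_const [intro]: "poly_tendsto (\<lambda>n. p) p"
  by (auto simp: poly_tendsto_def)

lemma poly_tendsto_pCons:
  assumes "x \<longlonglongrightarrow> a" "poly_tendsto p q"
  shows "poly_tendsto (\<lambda>n. pCons (x n) (p n)) (pCons a q)"
proof -
  obtain D where D: "\<And>n. degree (p n) \<le> D"
    using assms(2) by (auto simp: poly_tendsto_def)
  have "degree (pCons (x n) (p n)) \<le> Suc D" for n
    using D[of n] degree_pCons_le[of "x n" "p n"] by linarith
  then show ?thesis
    using assms unfolding poly_tendsto_def
    by (intro conjI exI[of _ "Suc D"] allI) (auto simp: coeff_pCons split: nat.splits)
qed

lemma poly_tendsto_add:
  assumes "poly_tendsto p q" "poly_tendsto p' q'"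
  shows "poly_tendsto (\<lambda>n. p n + p' n) (q + q')"
proof -
  obtain D where D: "\<And>n. degree (p n) \<le> D" using assms(1) by (auto simp: poly_tendsto_def)
  obtain D' where D': "\<And>n. degree (p' n) \<le> D'" using assms(2) by (auto simp: poly_tendsto_def)
  have "degree (p n + p' n) \<le> max D D'" for n
    using D[of n] D'[of n] by (intro degree_add_le) auto
  then show ?thesis using assms by (auto simp: poly_tendsto_def intro!: tendsto_add)
qed

lemma poly_tendsto_mult:
  assumes "poly_tendsto p q" "poly_tendsto p' q'"
  shows "poly_tendsto (\<lambda>n. p n * p' n) (q * q')"
proof -
  obtain D where D: "\<And>n. degree (p n) \<le> D" using assms(1) by (auto simp: poly_tendsto_def)
  obtain D' where D': "\<And>n. degree (p' n) \<le> D'" using assms(2) by (auto simp: poly_tendsto_def)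
  have "degree (p n * p' n) \<le> D + D'" for n
    using D[of n] D'[of n] degree_mult_le[of "p n" "p' n"] by linarith
  then show ?thesis
    using assms by (auto simp: poly_tendsto_def coeff_mult intro!: tendsto_sum tendsto_mult)
qed

lemma poly_tendsto_smult:
  assumes "x \<longlonglongrightarrow> a" "poly_tendsto p q"
  shows "poly_tendsto (\<lambda>n. smult (x n) (p n)) (smult a q)"
  using poly_tendsto_mult[OF poly_tendsto_pCons[OF assms(1) poly_tendsto_const[of 0]] assms(2)]
  by simp

lemma poly_tendsto_power:
  assumes "poly_tendsto p q"
  shows "poly_tendsto (\<lambda>n. p n ^ k) (q ^ k)"
  by (induction k) (auto intro: poly_tendsto_mult assms)

lemma poly_tendsto_sum:
  assumes "\<And>i. i \<in> I \<Longrightarrow> poly_tendsto (\<lambda>n. p n i) (q i)"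
  shows "poly_tendsto (\<lambda>n. \<Sum>i\<in>I. p n i) (\<Sum>i\<in>I. q i)"
  using assms by (induction I rule: infinite_finite_induct) (auto intro: poly_tendsto_add)

text \<open>A summation range that does not depend on the degree of \<open>p\<close> lets limits
  pass termwise, even when the degree drops in the limit.\<close>

lemma pcompose_eq_sum:
  fixes p q :: "'a :: comm_ring_1 poly"
  assumes "degree p \<le> D"
  shows "pcompose p q = (\<Sum>i\<le>D. smult (coeff p i) (q ^ i))"
proof -
  have "pcompose p q = (\<Sum>i\<le>degree p. smult (coeff p i) (q ^ i))"
    by (simp add: pcompose_altdef poly_altdef coeff_map_poly degree_map_poly)
  also have "\<dots> = (\<Sum>i\<le>D. smult (coeff p i) (q ^ i))"
    using assms by (intro sum.mono_neutral_left) (auto simp: coeff_eq_0)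
  finally show ?thesis .
qed

lemma poly_tendsto_pcompose:
  assumes "poly_tendsto p q" "poly_tendsto p' q'"
  shows "poly_tendsto (\<lambda>n. pcompose (p n) (p' n)) (pcompose q q')"
proof -
  obtain D where D: "\<And>n. degree (p n) \<le> D" "degree q \<le> D"
    using poly_tendsto_degreeE[OF assms(1)] by blast
  have "poly_tendsto (\<lambda>n. \<Sum>i\<le>D. smult (coeff (p n) i) (p' n ^ i)) (\<Sum>i\<le>D. smult (coeff q i) (q' ^ i))"
    using assms by (intro poly_tendsto_sum poly_tendsto_smult poly_tendsto_power poly_tendsto_coeff)
  then show ?thesis using D by (simp add: pcompose_eq_sum[of _ D])
qed

lemma poly_tendsto_pderiv:
  assumes "poly_tendsto p q"
  shows "poly_tendsto (\<lambda>n. pderiv (p n)) (pderiv q)"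
proof -
  obtain D where D: "\<And>n. degree (p n) \<le> D" using assms by (auto simp: poly_tendsto_def)
  have "degree (pderiv (p n)) \<le> D" for n
    using D[of n] by (simp add: degree_pderiv)
  then show ?thesis
    using assms by (auto simp: poly_tendsto_def coeff_pderiv intro!: tendsto_mult)
qed

lemma poly_tendsto_poly:
  assumes "poly_tendsto p q" "x \<longlonglongrightarrow> a"
  shows "(\<lambda>n. poly (p n) (x n)) \<longlonglongrightarrow> poly q a"
proof -
  \<comment> \<open>A constant inner polynomial turns the value at a moving point into a coefficient
    of a composition.\<close>
  have "poly_tendsto (\<lambda>n. pcompose (p n) [:x n:]) (pcompose q [:a:])"
    using assms by (intro poly_tendsto_pcompose poly_tendsto_pCons poly_tendsto_const)
  from poly_tendsto_coeff[OF this, of 0] show ?thesis by simp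
qed

section \<open>Subsequences, roots of limits and compactness\<close>

lemma poly_tendsto_subseq:
  assumes "poly_tendsto p q" "strict_mono r"
  shows "poly_tendsto (\<lambda>n. p (r n)) q"
  unfolding poly_tendsto_def
proof (intro conjI allI)
  show "\<exists>D. \<forall>n. degree (p (r n)) \<le> D"
    using assms(1) by (auto simp: poly_tendsto_def)
  show "(\<lambda>n. coeff (p (r n)) i) \<longlonglongrightarrow> coeff q i" for i
    using LIMSEQ_subseq_LIMSEQ[OF poly_tendsto_coeff[OF assms(1)] assms(2)] by (simp add: o_def)
qed

lemma poly_tendsto_uniform_limit:
  assumes "poly_tendsto p q" "compact K"
  shows "uniform_limit K (\<lambda>n. poly (p n)) (poly q) sequentially"
proof -
  obtain D where D: "\<And>n. degree (p n) \<le> D" "degree q \<le> D"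
    using poly_tendsto_degreeE[OF assms(1)] by blast
  have eq: "poly r = (\<lambda>z. \<Sum>i\<le>D. coeff r i * z ^ i)" if "degree r \<le> D" for r :: "complex poly"
    unfolding fun_eq_iff poly_altdef using that by (intro allI sum.mono_neutral_left) (auto simp: coeff_eq_0)
  have monom: "uniform_limit K (\<lambda>n z. coeff (p n) i * z ^ i) (\<lambda>z. coeff q i * z ^ i) sequentially" for i
  proof (rule uniform_lim_mult)
    show "uniform_limit K (\<lambda>n z. z ^ i) (\<lambda>z. z ^ i) sequentially"
      by (rule uniform_limit_const)
    show "bounded ((\<lambda>z. z ^ i) ` K)"
      using assms(2) by (intro compact_imp_bounded compact_continuous_image continuous_intros)
    show "uniform_limit K (\<lambda>n z. coeff (p n) i) (\<lambda>z. coeff q i) sequentially"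
      using poly_tendsto_coeff[OF assms(1), of i] by (simp add: uniform_limit_iff tendsto_iff eventually_mono)
    show "bounded ((\<lambda>z. coeff q i) ` K)"
      by (rule bounded_subset[of "{coeff q i}"]) auto
  qed
  have "uniform_limit K (\<lambda>n z. \<Sum>i\<in>I. coeff (p n) i * z ^ i) (\<lambda>z. \<Sum>i\<in>I. coeff q i * z ^ i)
          sequentially" for I
    by (induction I rule: infinite_finite_induct) (auto intro: uniform_limit_add monom uniform_limit_const)
  from this[of "{..D}"] show ?thesis using D by (simp add: eq)
qed

text \<open>Hurwitz's theorem, with the roots of \<^term>\<open>p n\<close> nearest to \<^term>\<open>s\<close> as witnesses.\<close>
lemma poly_tendsto_root:
  assumes "poly_tendsto p q" "q \<noteq> 0" "poly q s = 0"
  obtains x where "x \<longlonglongrightarrow> s" "\<forall>\<^sub>F n in sequentially. poly (p n) (x n) = 0"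
proof -
  \<comment> \<open>If a disc around \<open>s\<close> were free of roots for infinitely many
    \<open>n\<close>, Hurwitz's theorem along that subsequence would give
    \<open>poly q s \<noteq> 0\<close>.\<close>
  have near: "\<forall>\<^sub>F n in sequentially. \<exists>z. poly (p n) z = 0 \<and> dist z s < e" if "e > 0" for e
  proof (rule ccontr)
    assume "\<not> ?thesis"
    then have inf: "infinite {n. \<not> (\<exists>z. poly (p n) z = 0 \<and> dist z s < e)}"
      by (simp add: cofinite_eq_sequentially[symmetric] eventually_cofinite)
    from infinite_enumerate[OF inf] obtain r :: "nat \<Rightarrow> nat" where r: "strict_mono r"
      "\<And>n. \<not> (\<exists>z. poly (p (r n)) z = 0 \<and> dist z s < e)" by auto
    have "poly q s \<noteq> 0"
    proof (rule Hurwitz_no_zeros[of "ball s e" "\<lambda>n. poly (p (r n))" "poly q" s])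
      show "uniform_limit K (\<lambda>n. poly (p (r n))) (poly q) sequentially"
        if "compact K" "K \<subseteq> ball s e" for K
        using poly_tendsto_uniform_limit[OF poly_tendsto_subseq[OF assms(1) r(1)] that(1)] .
      show "\<not> poly q constant_on ball s e"
      proof
        assume "poly q constant_on ball s e"
        then have "ball s e \<subseteq> {z. poly q z = 0}"
          using assms(3) \<open>e > 0\<close> by (force simp: constant_on_def)
        then show False
          using poly_roots_finite[OF assms(2)] finite_subset uncountable_ball[OF \<open>e > 0\<close>, of s]
            countable_finite by blast
      qed
    qed (use r(2) \<open>e > 0\<close> in \<open>auto intro!: holomorphic_intros simp: dist_commute\<close>)
    with assms(3) show False by simp
  qed
  obtain k where k: "coeff q k \<noteq> 0" using assms(2) by (metis leading_coeff_neq_0)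
  have nz: "\<forall>\<^sub>F n in sequentially. p n \<noteq> 0"
    using tendsto_imp_eventually_ne[OF poly_tendsto_coeff[OF assms(1)] k]
    by (rule eventually_mono) auto
  \<comment> \<open>The nearest root is one choice that works for all radii at once.\<close>
  define x where "x n = arg_min_on (\<lambda>z. dist z s) {z. poly (p n) z = 0}" for n
  have x: "poly (p n) (x n) = 0 \<and> dist (x n) s < e"
    if "p n \<noteq> 0" "\<exists>z. poly (p n) z = 0 \<and> dist z s < e" for n e
  proof -
    have fin: "finite {z. poly (p n) z = 0}" and ne: "{z. poly (p n) z = 0} \<noteq> {}"
      using that poly_roots_finite by auto
    show ?thesis
      using arg_min_if_finite(1)[OF fin ne, of "\<lambda>z. dist z s"]
        arg_min_least[OF fin ne, of _ "\<lambda>z. dist z s"] that(2)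
      unfolding x_def by fastforce
  qed
  have ev: "\<forall>\<^sub>F n in sequentially. poly (p n) (x n) = 0 \<and> dist (x n) s < e" if "e > 0" for e
    using nz near[OF that] by eventually_elim (rule x)
  show thesis
  proof
    show "x \<longlonglongrightarrow> s"
      unfolding tendsto_iff by (intro allI impI, rule eventually_mono[OF ev]) auto
    show "\<forall>\<^sub>F n in sequentially. poly (p n) (x n) = 0"
      using ev[of 1] by (simp add: eventually_conj_iff)
  qed
qed

text \<open>By Tychonoff the coefficient sequences lie in a compact product of discs. A limit
  vanishes beyond \<open>D\<close>, so it is again a polynomial.\<close>

lemma poly_tendsto_compact:
  fixes p :: "nat \<Rightarrow> complex poly"
  assumes "\<And>n. degree (p n) \<le> D" "\<And>n i. cmod (coeff (p n) i) \<le> B"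
  obtains r q where "strict_mono r" "poly_tendsto (\<lambda>n. p (r n)) q"
proof -
  have "compact (PiE UNIV (\<lambda>i::nat. cball (0::complex) B))"
    using compactin_PiE[of "\<lambda>_. euclidean" UNIV "\<lambda>i::nat. cball (0::complex) B"]
    by (auto simp: euclidean_product_topology)
  then have "seq_compact (PiE UNIV (\<lambda>i::nat. cball (0::complex) B))"
    by (rule compact_imp_seq_compact)
  moreover have "\<forall>n. coeff (p n) \<in> PiE UNIV (\<lambda>i. cball 0 B)"
    using assms(2) by (auto simp: PiE_def Pi_def)
  ultimately obtain l r where r: "strict_mono r" "((\<lambda>n. coeff (p n)) \<circ> r) \<longlonglongrightarrow> l"
    by (rule seq_compactE)
  have lim: "(\<lambda>n. coeff (p (r n)) i) \<longlonglongrightarrow> l i" for i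
  proof -
    have "isCont (\<lambda>l :: nat \<Rightarrow> complex. l i) l"
      using continuous_on_product_coordinates[of i] continuous_on_eq_continuous_at[OF open_UNIV]
      by blast
    from isCont_tendsto_compose[OF this r(2)] show ?thesis by (simp add: o_def)
  qed
  have l0: "l i = 0" if "i > D" for i
  proof -
    have "coeff (p n) i = 0" for n
      using assms(1)[of n] that by (intro coeff_eq_0) linarith
    then show ?thesis
      using lim[of i] LIMSEQ_unique[OF _ tendsto_const] by simp
  qed
  have "coeff (Abs_poly l) = l"
    using l0 by (intro coeff_Abs_poly) auto
  then have "poly_tendsto (\<lambda>n. p (r n)) (Abs_poly l)"
    using assms(1) lim by (auto simp: poly_tendsto_def)
  with r(1) show thesis by (rule that)
qed

section \<open>Blowing up at two fixed points\<close>

text \<open>A root of order \<open>m \<ge> 2\<close> of \<open>Q\<close> has order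
  \<open>m - 1 \<ge> m / 2\<close> in the derivative.\<close>

lemma degree_le_order_pderiv:
  fixes Q :: "complex poly"
  assumes "Q \<noteq> 0" "\<And>z. poly Q z = 0 \<Longrightarrow> poly (pderiv Q) z = 0"
  shows "degree Q \<le> 2 * (\<Sum>z | poly Q z = 0. order z (pderiv Q))"
proof (cases "degree Q = 0")
  case False
  then have nz: "pderiv Q \<noteq> 0" by (simp add: pderiv_eq_0_iff)
  have "degree Q = (\<Sum>z | poly Q z = 0. order z Q)"
    using assms(1) size_proots_complex[of Q] by (simp add: size_multiset_overloaded_eq)
  also have "\<dots> \<le> (\<Sum>z | poly Q z = 0. 2 * order z (pderiv Q))"
  proof (rule sum_mono)
    fix z assume "z \<in> {z. poly Q z = 0}"
    then have "order z Q = Suc (order z (pderiv Q))" "order z (pderiv Q) \<noteq> 0"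
      using assms nz by (auto simp: order_pderiv order_root)
    then show "order z Q \<le> 2 * order z (pderiv Q)" by linarith
  qed
  finally show ?thesis by (simp add: sum_distrib_left)
qed simp

text \<open>
  If all preimages of \<open>0\<close> and of \<open>c\<close> were multiple, each of these two fibres would account
  for at least half of \<open>degree H\<close> critical points, which is one too many.
\<close>
lemma ex_simple_preimage:
  fixes H :: "complex poly"
  assumes deg: "degree H > 0" and mult: "\<And>z. poly H z = 0 \<Longrightarrow> poly (pderiv H) z = 0"
    and "c \<noteq> 0"
  shows "\<exists>s. poly H s = c \<and> poly (pderiv H) s \<noteq> 0"
proof (rule ccontr)
  assume contra: "\<not> ?thesis"
  define Q where "Q = H - [:c:]"
  have nz: "H \<noteq> 0" "pderiv H \<noteq> 0" "Q \<noteq> 0"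
    using deg by (auto simp: pderiv_eq_0_iff Q_def)
  have Q: "pderiv Q = pderiv H" by (simp add: Q_def pderiv_diff pderiv_pCons)
  have degQ: "degree Q = degree H"
    using deg by (simp add: Q_def diff_conv_add_uminus degree_add_eq_left del: add_uminus_conv_diff)
  have "degree H \<le> 2 * (\<Sum>z | poly H z = 0. order z (pderiv H))"
    using nz mult by (intro degree_le_order_pderiv)
  moreover have "degree H \<le> 2 * (\<Sum>z | poly Q z = 0. order z (pderiv H))"
    using degree_le_order_pderiv[of Q] nz contra unfolding Q degQ by (auto simp: Q_def)
  moreover have "(\<Sum>z | poly H z = 0. order z (pderiv H)) + (\<Sum>z | poly Q z = 0. order z (pderiv H))
      \<le> degree (pderiv H)"
  proof -
    have fin: "finite {z. poly H z = 0}" "finite {z. poly Q z = 0}"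
      using nz poly_roots_finite by auto
    have "(\<Sum>z | poly H z = 0. order z (pderiv H)) + (\<Sum>z | poly Q z = 0. order z (pderiv H))
        = (\<Sum>z\<in>{z. poly H z = 0} \<union> {z. poly Q z = 0}. order z (pderiv H))"
      using fin \<open>c \<noteq> 0\<close> by (intro sum.union_disjoint[symmetric]) (auto simp: Q_def)
    also have "\<dots> \<le> (\<Sum>z | poly (pderiv H) z = 0. order z (pderiv H))"
    proof (rule sum_mono2)
      show "finite {z. poly (pderiv H) z = 0}" using nz poly_roots_finite by auto
      show "{z. poly H z = 0} \<union> {z. poly Q z = 0} \<subseteq> {z. poly (pderiv H) z = 0}"
        using mult contra by (auto simp: Q_def)
    qed auto
    also have "\<dots> = degree (pderiv H)"
      using nz size_proots_complex[of "pderiv H"] by (simp add: size_multiset_overloaded_eq)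
    finally show ?thesis .
  qed
  ultimately show False using deg by (simp add: degree_pderiv)
qed

text \<open>Scaling multiplies the coefficient of index \<open>i\<close> by
  \<open>\<rho> ^ i\<close>. The least of the scales at which a single coefficient reaches modulus
  \<open>1\<close> serves as \<open>\<rho>\<close>; index \<open>0\<close>, which scaling cannot
  change, is absent since \<open>poly P 0 = 0\<close>.\<close>

lemma ex_rescaling:
  fixes P :: "complex poly"
  assumes "degree P \<ge> 1" "poly P 0 = 0"
  obtains \<rho> :: real where "\<rho> > 0"
    "\<And>i. cmod (coeff (pcompose P [:0, of_real \<rho>:]) i) \<le> 1"
    "\<exists>i\<le>degree P. cmod (coeff (pcompose P [:0, of_real \<rho>:]) i) = 1"
proof -
  define S where "S = {i. 1 \<le> i \<and> i \<le> degree P \<and> coeff P i \<noteq> 0}"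
  define \<phi> where "\<phi> i = root i (1 / cmod (coeff P i))" for i
  define \<rho> where "\<rho> = Min (\<phi> ` S)"
  have S: "finite S" "degree P \<in> S"
    using assms(1) by (auto simp: S_def)
  have pos: "\<phi> i > 0" and pow: "\<phi> i ^ i * cmod (coeff P i) = 1" if "i \<in> S" for i
    using that by (auto simp: S_def \<phi>_def)
  have mem: "\<rho> \<in> \<phi> ` S"
    unfolding \<rho>_def using S by (intro Min_in) auto
  then have "\<rho> > 0" using pos by auto
  have c: "cmod (coeff (pcompose P [:0, of_real \<rho>:]) i) = \<rho> ^ i * cmod (coeff P i)" for i
    using \<open>\<rho> > 0\<close> by (simp add: coeff_pcompose_linear norm_mult norm_power)
  show thesis
  proof
    show "\<rho> > 0" by fact
    show "cmod (coeff (pcompose P [:0, of_real \<rho>:]) i) \<le> 1" for i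
    proof (cases "i \<in> S")
      case True
      then have "\<rho> \<le> \<phi> i" unfolding \<rho>_def using S by (intro Min_le) auto
      then have "\<rho> ^ i * cmod (coeff P i) \<le> \<phi> i ^ i * cmod (coeff P i)"
        using \<open>\<rho> > 0\<close> by (intro mult_right_mono power_mono) auto
      then show ?thesis using pow[OF True] c by simp
    next
      case False
      have "coeff P i = 0"
      proof (cases "i = 0")
        case True
        then show ?thesis using assms(2) by (simp add: poly_0_coeff_0)
      next
        case False
        then show ?thesis using \<open>i \<notin> S\<close> by (cases "i \<le> degree P") (auto simp: S_def coeff_eq_0)
      qed
      then show ?thesis using c by simp
    qed
    show "\<exists>i\<le>degree P. cmod (coeff (pcompose P [:0, of_real \<rho>:]) i) = 1"
      using mem pow c by (auto simp: S_def)
  qed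
qed

text \<open>This bound and the next speak of points rather than of the multisets
  \<open>multipliers\<close>, which gives direct access to conjugation and to limits of
  points.\<close>

definition fixed_bound :: "real \<Rightarrow> complex poly \<Rightarrow> bool"
  where "fixed_bound R g \<longleftrightarrow> (\<forall>z. poly g z = z \<longrightarrow> cmod (poly (pderiv g) z) \<le> R)"

definition two_cycle_bound :: "real \<Rightarrow> complex poly \<Rightarrow> bool"
  where "two_cycle_bound R g \<longleftrightarrow> (\<forall>z. poly g (poly g z) = z \<longrightarrow> poly g z \<noteq> z \<longrightarrow>
           cmod (poly (pderiv g) (poly g z) * poly (pderiv g) z) \<le> R)"

section \<open>Limits of rescalings around a fixed point\<close>

lemma degree_minus_id:
  fixes g :: "complex poly"
  assumes "degree g \<ge> 2"
  shows "degree (g - [:0, 1:]) = degree g" "lead_coeff (g - [:0, 1:]) = lead_coeff g"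
proof -
  have "degree (g + - [:0, 1:]) = degree g" using assms by (intro degree_add_eq_left) simp
  then show *: "degree (g - [:0, 1:]) = degree g" by (simp only: add_uminus_conv_diff)
  show "lead_coeff (g - [:0, 1:]) = lead_coeff g"
    unfolding * using assms by (simp add: coeff_pCons split: nat.splits)
qed

text \<open>Normalised rescalings of \<open>g n - [:0, 1:]\<close> around \<open>x\<close> converge
  along a subsequence. Roots of the limit come from fixed points of \<open>g n\<close>, where the
  chain rule makes the rescaled derivative \<open>\<rho> n\<close> times a bounded quantity.\<close>

lemma blowup_at_fixed_point:
  assumes d: "d \<ge> 2" "\<And>n. degree (g n) = d" and fp: "\<And>n. poly (g n) x = x"
    and lc: "filterlim (\<lambda>n. cmod (lead_coeff (g n))) at_top sequentially"
    and R: "\<And>n. fixed_bound R (g n)"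
  obtains r :: "nat \<Rightarrow> nat" and \<rho> :: "nat \<Rightarrow> complex" and H where
    "strict_mono r" "\<And>n. \<rho> n \<noteq> 0" "\<rho> \<longlonglongrightarrow> 0"
    "poly_tendsto (\<lambda>n. pcompose (g (r n) - [:0, 1:]) [:x, \<rho> n:]) H"
    "degree H > 0" "\<And>z. poly H z = 0 \<Longrightarrow> poly (pderiv H) z = 0"
proof -
  define P where "P n = pcompose (g n - [:0, 1:]) [:x, 1:]" for n
  have degP: "degree (P n) = d" and lcP: "coeff (P n) d = lead_coeff (g n)" for n
  proof -
    show *: "degree (P n) = d" using degree_minus_id[of "g n"] d by (simp add: P_def degree_pcompose)
    have "lead_coeff (P n) = lead_coeff (g n)"
      using degree_minus_id[of "g n"] d by (simp add: P_def lead_coeff_comp)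
    then show "coeff (P n) d = lead_coeff (g n)" unfolding * .
  qed
  have "\<exists>\<rho>. \<rho> > 0 \<and> (\<forall>i. cmod (coeff (pcompose (P n) [:0, of_real \<rho>:]) i) \<le> 1) \<and>
      (\<exists>i\<le>d. cmod (coeff (pcompose (P n) [:0, of_real \<rho>:]) i) = 1)" for n
  proof -
    have "degree (P n) \<ge> 1" "poly (P n) 0 = 0"
      using d fp degP by (auto simp: P_def poly_pcompose)
    from ex_rescaling[OF this] show ?thesis unfolding degP by metis
  qed
  then obtain \<rho> :: "nat \<Rightarrow> real" where \<rho>: "\<And>n. \<rho> n > 0"
    "\<And>n i. cmod (coeff (pcompose (P n) [:0, of_real (\<rho> n):]) i) \<le> 1"
    "\<And>n. \<exists>i\<le>d. cmod (coeff (pcompose (P n) [:0, of_real (\<rho> n):]) i) = 1"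
    by metis
  define h where "h n = pcompose (P n) [:0, of_real (\<rho> n):]" for n
  have degh: "degree (h n) \<le> d" for n
    using \<rho>(1)[of n] by (simp add: h_def degree_pcompose degP)
  obtain r H where r: "strict_mono r" "poly_tendsto (\<lambda>n. h (r n)) H"
    using poly_tendsto_compact[of h d 1] degh \<rho>(2) by (auto simp: h_def)
  have h_eq: "h n = pcompose (g n - [:0, 1:]) [:x, of_real (\<rho> n):]" for n
    by (simp add: h_def P_def pcompose_assoc[symmetric] pcompose_pCons)
  \<comment> \<open>The rescaled leading coefficient is \<open>\<rho> n ^ d\<close> times that of
    \<open>g n\<close>, and its modulus is at most \<open>1\<close>.\<close>
  have "(\<lambda>n. \<rho> n ^ d) \<longlonglongrightarrow> 0"
  proof (rule tendsto_sandwich[OF _ _ tendsto_const])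
    show "(\<lambda>n. 1 / cmod (lead_coeff (g n))) \<longlonglongrightarrow> 0"
      using tendsto_inverse_0_at_top[OF lc] by (simp add: inverse_eq_divide)
    have "\<rho> n ^ d \<le> 1 / cmod (lead_coeff (g n))" for n
    proof -
      have "\<rho> n ^ d * cmod (lead_coeff (g n)) \<le> 1"
        using \<rho>(2)[of n d] \<rho>(1)[of n] by (simp add: coeff_pcompose_linear norm_mult norm_power lcP)
      moreover have "lead_coeff (g n) \<noteq> 0" using d by (metis degree_0 leading_coeff_0_iff not_numeral_le_zero)
      ultimately show ?thesis by (simp add: pos_le_divide_eq)
    qed
    then show "\<forall>\<^sub>F n in sequentially. \<rho> n ^ d \<le> 1 / cmod (lead_coeff (g n))" by simp
    show "\<forall>\<^sub>F n in sequentially. 0 \<le> \<rho> n ^ d" using \<rho>(1) by (simp add: less_imp_le)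
  qed
  then have "(\<lambda>n. root d (\<rho> n ^ d)) \<longlonglongrightarrow> root d 0"
    by (rule tendsto_real_root)
  then have "\<rho> \<longlonglongrightarrow> 0"
    using d(1) \<rho>(1) by (simp add: real_root_power_cancel less_imp_le)
  then have \<rho>0: "(\<lambda>n. complex_of_real (\<rho> (r n))) \<longlonglongrightarrow> 0"
    using LIMSEQ_subseq_LIMSEQ[OF _ r(1), of \<rho> 0] tendsto_of_real[of "\<lambda>n. \<rho> (r n)" 0 sequentially]
    by (simp add: o_def)
  show thesis
  proof
    show "strict_mono r" by fact
    show "of_real (\<rho> (r n)) \<noteq> (0 :: complex)" for n using \<rho>(1)[of "r n"] by simp
    show "(\<lambda>n. complex_of_real (\<rho> (r n))) \<longlonglongrightarrow> 0" by fact
    show "poly_tendsto (\<lambda>n. pcompose (g (r n) - [:0, 1:]) [:x, complex_of_real (\<rho> (r n)):]) H"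
      using r(2) by (simp add: h_eq)
    \<comment> \<open>A constant \<open>H\<close> would be \<open>0\<close> because \<open>x\<close>
      is fixed; but some coefficient among the finitely many indices up to \<open>d\<close> always
      has modulus \<open>1\<close>.\<close>
    show "degree H > 0"
    proof (rule ccontr)
      assume "\<not> degree H > 0"
      moreover have "coeff H 0 = 0"
      proof -
        have "coeff (h n) 0 = 0" for n using fp by (simp add: h_eq)
        then show ?thesis
          using poly_tendsto_coeff[OF r(2), of 0] LIMSEQ_unique[OF _ tendsto_const] by simp
      qed
      ultimately have "H = 0" by (metis degree_eq_zeroE coeff_pCons_0 pCons_0_0 gr0I)
      then have "\<forall>\<^sub>F n in sequentially. cmod (coeff (h (r n)) i) < 1" for i
        using poly_tendsto_coeff[OF r(2), of i] by (intro order_tendstoD(2)[OF tendsto_norm]) auto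
      then have "\<forall>\<^sub>F n in sequentially. \<forall>i\<in>{..d}. cmod (coeff (h (r n)) i) < 1"
        by (intro eventually_ball_finite) auto
      then obtain n where "\<forall>i\<in>{..d}. cmod (coeff (h (r n)) i) < 1"
        using eventually_happens'[OF sequentially_bot] by blast
      then show False using \<rho>(3)[of "r n"] by (force simp: h_def)
    qed
    then have "H \<noteq> 0" by auto
    show "poly (pderiv H) z = 0" if root: "poly H z = 0" for z
    proof -
      obtain s where s: "s \<longlonglongrightarrow> z" "\<forall>\<^sub>F n in sequentially. poly (h (r n)) (s n) = 0"
        using poly_tendsto_root[OF r(2) \<open>H \<noteq> 0\<close> root] by blast
      have "(\<lambda>n. poly (pderiv (h (r n))) (s n)) \<longlonglongrightarrow> 0"
      proof (rule Lim_null_comparison)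
        show "\<forall>\<^sub>F n in sequentially. cmod (poly (pderiv (h (r n))) (s n)) \<le> \<rho> (r n) * (R + 1)"
          using s(2)
        proof eventually_elim
          case (elim n)
          let ?z = "x + of_real (\<rho> (r n)) * s n"
          have "poly (g (r n)) ?z = ?z"
            using elim by (simp add: h_eq poly_pcompose mult.commute)
          then have "cmod (poly (pderiv (g (r n))) ?z) \<le> R"
            using R by (auto simp: fixed_bound_def)
          then have "cmod (poly (pderiv (g (r n))) ?z - 1) \<le> R + 1"
            by (metis add_right_mono norm_one norm_triangle_ineq4 order_trans)
          moreover have "poly (pderiv (h (r n))) (s n)
              = of_real (\<rho> (r n)) * (poly (pderiv (g (r n))) ?z - 1)"
            by (simp add: h_eq pderiv_pcompose poly_pcompose pderiv_diff pderiv_pCons mult.commute)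
          ultimately show ?case
            using \<rho>(1)[of "r n"] by (simp add: norm_mult)
        qed
        show "(\<lambda>n. \<rho> (r n) * (R + 1)) \<longlonglongrightarrow> 0"
          using LIMSEQ_subseq_LIMSEQ[OF \<open>\<rho> \<longlonglongrightarrow> 0\<close> r(1)] by (intro tendsto_mult_left_zero) (simp add: o_def)
      qed
      moreover have "(\<lambda>n. poly (pderiv (h (r n))) (s n)) \<longlonglongrightarrow> poly (pderiv H) z"
        using poly_tendsto_poly[OF poly_tendsto_pderiv[OF r(2)] s(1)] .
      ultimately show ?thesis using LIMSEQ_unique by blast
    qed
  qed
qed

text \<open>
  Decoupling: in the coordinates \<open>z = \<rho> n * s\<close> near \<open>0\<close> and \<open>z = 1 + \<sigma> n * t\<close> near \<open>1\<close>, the equations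
  of a \<open>2\<close>-cycle of \<open>z + P n z\<close> tend to \<open>H s = 1\<close> and \<open>K t = -1\<close>. A further rescaling by
  \<open>\<sigma> n\<close> around a solution \<open>x n\<close> of the first equation with fixed target \<open>1 + \<sigma> n * t\<^sub>0\<close> makes the
  first return map converge as well.
\<close>
lemma ex_two_cycle_near:
  assumes \<rho>: "\<And>n. \<rho> n \<noteq> 0" "\<rho> \<longlonglongrightarrow> 0" and \<sigma>: "\<And>n. \<sigma> n \<noteq> 0" "\<sigma> \<longlonglongrightarrow> 0"
    and H: "poly_tendsto (\<lambda>n. pcompose (P n) [:0, \<rho> n:]) H"
    and K: "poly_tendsto (\<lambda>n. pcompose (P n) [:1, \<sigma> n:]) K"
    and s0: "poly H s0 = 1" "poly (pderiv H) s0 \<noteq> 0"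
    and t0: "poly K t0 = -1" and degK: "degree K > 0"
  obtains s t where "s \<longlonglongrightarrow> s0" "t \<longlonglongrightarrow> t0"
    "\<forall>\<^sub>F n in sequentially. \<rho> n * s n + poly (P n) (\<rho> n * s n) = 1 + \<sigma> n * t n"
    "\<forall>\<^sub>F n in sequentially. 1 + \<sigma> n * t n + poly (P n) (1 + \<sigma> n * t n) = \<rho> n * s n"
proof -
  define h where "h n = pcompose (P n) [:0, \<rho> n:]" for n
  define k where "k n = pcompose (P n) [:1, \<sigma> n:]" for n
  have h: "poly_tendsto h H" and k: "poly_tendsto k K"
    using H K by (simp_all add: h_def[abs_def] k_def[abs_def])
  have \<sigma>c: "(\<lambda>n. c * \<sigma> n) \<longlonglongrightarrow> 0" for c
    using tendsto_mult_right_zero[OF \<sigma>(2)] .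
  \<comment> \<open>\<open>poly (A n) y = 0\<close> says that \<open>z + P n z\<close> maps
    \<open>\<rho> n * y\<close> to \<open>1 + \<sigma> n * t0\<close>; the limit equation is
    \<open>H = 1\<close>.\<close>
  define A where "A n = h n + [:- 1 - t0 * \<sigma> n, \<rho> n:]" for n
  have "poly_tendsto A (H + [:- 1 - 0, 0:])"
    unfolding A_def[abs_def]
    by (intro poly_tendsto_add poly_tendsto_pCons tendsto_diff tendsto_const poly_tendsto_const \<rho> h \<sigma>c)
  moreover have "H + [:- 1 - 0, 0:] \<noteq> 0"
  proof
    assume "H + [:- 1 - 0, 0:] = 0"
    then have "H = [:1:]" by (simp add: add_eq_0_iff2)
    then show False using s0(2) by simp
  qed
  moreover have "poly (H + [:- 1 - 0, 0:]) s0 = 0" using s0 by simp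
  ultimately obtain x where x: "x \<longlonglongrightarrow> s0" "\<forall>\<^sub>F n in sequentially. poly (A n) (x n) = 0"
    by (rule poly_tendsto_root)
  \<comment> \<open>\<open>u n\<close> is the displacement from \<open>1\<close> of the image of
    \<open>\<rho> n * (x n + y)\<close>, as a polynomial in \<open>y\<close>.\<close>
  define u where "u n = pcompose (h n) [:x n, 1:] + [:\<rho> n * x n - 1, \<rho> n:]" for n
  define U where "U = pcompose H [:s0, 1:] + [:0 * s0 - 1, 0:]"
  have u: "poly_tendsto u U"
    unfolding u_def[abs_def] U_def
    by (intro poly_tendsto_add poly_tendsto_pcompose poly_tendsto_pCons tendsto_diff tendsto_mult
        tendsto_const poly_tendsto_const \<rho> h x)
  have U1: "coeff U 1 = poly (pderiv H) s0"
  proof -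
    have "coeff U 1 = coeff (pderiv U) 0" by (simp add: coeff_pderiv)
    also have "\<dots> = poly (pderiv H) s0"
      by (simp add: U_def pderiv_add pderiv_pcompose pderiv_pCons)
    finally show ?thesis .
  qed
  define m where "m = poly (pderiv H) s0"
  \<comment> \<open>\<open>T n\<close> takes \<open>y\<close> to the coordinate \<open>t\<close> of
    the image of \<open>\<rho> n * (x n + \<sigma> n * y)\<close>. Eventually
    \<open>poly (u n) 0 = t0 * \<sigma> n\<close>, so division by \<open>\<sigma> n\<close> leaves a
    limit; the terms of degree above \<open>1\<close> die out.\<close>
  define T where "T n = smult (1 / \<sigma> n) (pcompose (u n) [:0, \<sigma> n:])" for n
  have T: "poly_tendsto T [:t0, m:]"
  proof -
    obtain D where D: "\<And>n. degree (u n) \<le> D" using u by (auto simp: poly_tendsto_def)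
    have "degree (T n) \<le> D" for n
      using D[of n] \<sigma>(1)[of n] by (simp add: T_def degree_pcompose)
    moreover have "(\<lambda>n. coeff (T n) i) \<longlonglongrightarrow> coeff [:t0, m:] i" for i
    proof (cases i)
      case 0
      have "\<forall>\<^sub>F n in sequentially. coeff (T n) i = t0"
        using x(2)
      proof eventually_elim
        case (elim n)
        then have "poly (u n) 0 = t0 * \<sigma> n"
          by (simp add: u_def A_def poly_pcompose algebra_simps)
        then show ?case
          using \<sigma>(1)[of n] 0 by (simp add: T_def coeff_pcompose_linear)
      qed
      then show ?thesis using 0 by (auto dest: tendsto_eventually)
    next
      case (Suc j)
      have "coeff (T n) i = \<sigma> n ^ j * coeff (u n) i" for n
        using \<sigma>(1)[of n] Suc by (simp add: T_def coeff_pcompose_linear)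
      moreover have "(\<lambda>n. \<sigma> n ^ j * coeff (u n) i) \<longlonglongrightarrow> 0 ^ j * coeff U i"
        by (intro tendsto_intros \<sigma> poly_tendsto_coeff[OF u])
      moreover have "0 ^ j * coeff U i = coeff [:t0, m:] i"
        using U1 Suc by (cases j) (auto simp: m_def)
      ultimately show ?thesis by simp
    qed
    ultimately show ?thesis by (auto simp: poly_tendsto_def)
  qed
  \<comment> \<open>\<open>poly (E n) y = 0\<close> closes the cycle:
    \<open>1 + \<sigma> n * poly (T n) y\<close> returns to the starting point. The limit is
    \<open>K + 1\<close> composed with \<open>[:t0, m:]\<close>, nonzero because \<open>K\<close> is
    nonconstant and \<open>m \<noteq> 0\<close>.\<close>
  define E where "E n = pcompose (k n) (T n) + smult (\<sigma> n) (T n) + [:1 - \<rho> n * x n, - \<rho> n * \<sigma> n:]" for n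
  define E' where "E' = pcompose K [:t0, m:] + smult 0 [:t0, m:] + [:1 - 0 * s0, - 0 * 0:]"
  have "poly_tendsto E E'"
    unfolding E_def[abs_def] E'_def
    by (intro poly_tendsto_add poly_tendsto_pcompose poly_tendsto_pCons poly_tendsto_smult
        tendsto_diff tendsto_mult tendsto_minus tendsto_const poly_tendsto_const \<rho> \<sigma> T k x)
  moreover have "E' \<noteq> 0"
  proof
    assume "E' = 0"
    then have "pcompose K [:t0, m:] = [:-1:]" by (simp add: E'_def add_eq_0_iff2)
    then have "degree (pcompose K [:t0, m:]) = 0" by simp
    then show False using degK s0(2) by (simp add: degree_pcompose m_def)
  qed
  moreover have "poly E' 0 = 0" using t0 by (simp add: E'_def poly_pcompose)
  ultimately obtain \<tau> where \<tau>: "\<tau> \<longlonglongrightarrow> 0" "\<forall>\<^sub>F n in sequentially. poly (E n) (\<tau> n) = 0"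
    by (rule poly_tendsto_root)
  show thesis
  proof
    show "(\<lambda>n. x n + \<sigma> n * \<tau> n) \<longlonglongrightarrow> s0"
      using tendsto_add[OF x(1) tendsto_mult[OF \<sigma>(2) \<tau>(1)]] by simp
    show "(\<lambda>n. poly (T n) (\<tau> n)) \<longlonglongrightarrow> t0"
      using poly_tendsto_poly[OF T \<tau>(1)] by simp
    have T_eq: "\<sigma> n * poly (T n) (\<tau> n) = poly (u n) (\<sigma> n * \<tau> n)" for n
      using \<sigma>(1)[of n] by (simp add: T_def poly_pcompose mult.commute)
    then have "\<rho> n * (x n + \<sigma> n * \<tau> n) + poly (P n) (\<rho> n * (x n + \<sigma> n * \<tau> n))
        = 1 + \<sigma> n * poly (T n) (\<tau> n)" for n
      unfolding T_eq by (simp add: u_def h_def poly_pcompose algebra_simps)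
    then show "\<forall>\<^sub>F n in sequentially. \<rho> n * (x n + \<sigma> n * \<tau> n) + poly (P n) (\<rho> n * (x n + \<sigma> n * \<tau> n))
        = 1 + \<sigma> n * poly (T n) (\<tau> n)" by simp
    show "\<forall>\<^sub>F n in sequentially. 1 + \<sigma> n * poly (T n) (\<tau> n) + poly (P n) (1 + \<sigma> n * poly (T n) (\<tau> n))
        = \<rho> n * (x n + \<sigma> n * \<tau> n)"
      using \<tau>(2) by eventually_elim (simp add: E_def k_def poly_pcompose algebra_simps)
  qed
qed

text \<open>The multiplier of a \<open>2\<close>-cycle between neighbourhoods of \<open>0\<close>
  and \<open>1\<close>, times \<open>\<rho> n * \<sigma> n\<close>, tends to the product of the
  derivatives of \<open>H\<close> and \<open>K\<close> at simple solutions, which is nonzero; a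
  bound \<open>R\<close> forces the limit \<open>0\<close>.\<close>

lemma no_bounded_blowup:
  assumes d: "d \<ge> 2" "\<And>n. degree (g n) = d"
    and fp: "\<And>n. poly (g n) 0 = 0" "\<And>n. poly (g n) 1 = 1"
    and lc: "filterlim (\<lambda>n. cmod (lead_coeff (g n))) at_top sequentially"
    and R: "\<And>n. fixed_bound R (g n)" "\<And>n. two_cycle_bound R (g n)"
  shows False
proof -
  obtain r1 \<rho>' H where 1: "strict_mono r1" "\<And>n. \<rho>' n \<noteq> 0" "\<rho>' \<longlonglongrightarrow> 0"
    "poly_tendsto (\<lambda>n. pcompose (g (r1 n) - [:0, 1:]) [:0, \<rho>' n:]) H"
    "degree H > 0" "\<And>z. poly H z = 0 \<Longrightarrow> poly (pderiv H) z = 0"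
    by (rule blowup_at_fixed_point[OF d fp(1) lc R(1)]) blast
  have lc': "filterlim (\<lambda>n. cmod (lead_coeff (g (r1 n)))) at_top sequentially"
    using filterlim_compose[OF lc filterlim_subseq[OF 1(1)]] .
  \<comment> \<open>The second blow-up runs along the first subsequence, so that both limits exist
    along a common one.\<close>
  obtain r2 \<sigma> K where 2: "strict_mono r2" "\<And>n. \<sigma> n \<noteq> 0" "\<sigma> \<longlonglongrightarrow> 0"
    "poly_tendsto (\<lambda>n. pcompose (g (r1 (r2 n)) - [:0, 1:]) [:1, \<sigma> n:]) K"
    "degree K > 0" "\<And>z. poly K z = 0 \<Longrightarrow> poly (pderiv K) z = 0"
    by (rule blowup_at_fixed_point[of d "\<lambda>n. g (r1 n)" 1 R]) (use d fp lc' R in blast)+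
  obtain s0 where s0: "poly H s0 = 1" "poly (pderiv H) s0 \<noteq> 0"
    using ex_simple_preimage[OF 1(5,6), of 1] by auto
  obtain t0 where t0: "poly K t0 = -1" "poly (pderiv K) t0 \<noteq> 0"
    using ex_simple_preimage[OF 2(5,6), of "-1"] by auto
  define G where "G n = g (r1 (r2 n))" for n
  define P where "P n = G n - [:0, 1:]" for n
  define \<rho> where "\<rho> n = \<rho>' (r2 n)" for n
  define h where "h n = pcompose (P n) [:0, \<rho> n:]" for n
  define k where "k n = pcompose (P n) [:1, \<sigma> n:]" for n
  have \<rho>: "\<And>n. \<rho> n \<noteq> 0" "\<rho> \<longlonglongrightarrow> 0"
    using 1(2) LIMSEQ_subseq_LIMSEQ[OF 1(3) 2(1)] by (auto simp: \<rho>_def[abs_def] o_def)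
  have h: "poly_tendsto h H"
    using poly_tendsto_subseq[OF 1(4) 2(1)] by (simp add: h_def[abs_def] P_def G_def \<rho>_def)
  have k: "poly_tendsto k K"
    using 2(4) by (simp add: k_def[abs_def] P_def G_def)
  obtain s t where st: "s \<longlonglongrightarrow> s0" "t \<longlonglongrightarrow> t0"
    "\<forall>\<^sub>F n in sequentially. \<rho> n * s n + poly (P n) (\<rho> n * s n) = 1 + \<sigma> n * t n"
    "\<forall>\<^sub>F n in sequentially. 1 + \<sigma> n * t n + poly (P n) (1 + \<sigma> n * t n) = \<rho> n * s n"
    by (rule ex_two_cycle_near[OF \<rho> 2(2,3) h[unfolded h_def[abs_def]] k[unfolded k_def[abs_def]] s0 t0(1) 2(5)])
  \<comment> \<open>The two points tend to \<open>0\<close> and \<open>1\<close>, so they form a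
    genuine cycle, as \<open>two_cycle_bound\<close> demands.\<close>
  have sep: "\<forall>\<^sub>F n in sequentially. 1 + \<sigma> n * t n - \<rho> n * s n \<noteq> 0"
  proof (rule tendsto_imp_eventually_ne)
    show "(\<lambda>n. 1 + \<sigma> n * t n - \<rho> n * s n) \<longlonglongrightarrow> 1 + 0 * t0 - 0 * s0"
      by (intro tendsto_intros st \<rho> 2(3))
  qed simp
  define q where "q n = (\<sigma> n + poly (pderiv (k n)) (t n)) * (\<rho> n + poly (pderiv (h n)) (s n))" for n
  have "q \<longlonglongrightarrow> (0 + poly (pderiv K) t0) * (0 + poly (pderiv H) s0)"
    unfolding q_def[abs_def]
    by (intro tendsto_mult tendsto_add \<rho> 2(3) poly_tendsto_poly poly_tendsto_pderiv h k st(1,2))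
  moreover have "q \<longlonglongrightarrow> 0"
  proof (rule Lim_null_comparison)
    show "(\<lambda>n. cmod (\<sigma> n) * cmod (\<rho> n) * R) \<longlonglongrightarrow> 0"
      using tendsto_mult[OF tendsto_norm[OF 2(3)] tendsto_norm[OF \<rho>(2)]]
      by (intro tendsto_mult_left_zero) simp
    show "\<forall>\<^sub>F n in sequentially. cmod (q n) \<le> cmod (\<sigma> n) * cmod (\<rho> n) * R"
      using st(3,4) sep
    proof eventually_elim
      case (elim n)
      let ?z = "\<rho> n * s n" and ?w = "1 + \<sigma> n * t n"
      have "poly (G n) ?z = ?w" "poly (G n) ?w = ?z" "?w \<noteq> ?z"
        using elim by (simp_all add: P_def)
      then have "cmod (poly (pderiv (G n)) ?w * poly (pderiv (G n)) ?z) \<le> R"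
        using R(2) unfolding two_cycle_bound_def G_def by metis
      moreover have "\<sigma> n + poly (pderiv (k n)) (t n) = \<sigma> n * poly (pderiv (G n)) ?w"
        by (simp add: k_def P_def pderiv_pcompose poly_pcompose pderiv_diff pderiv_pCons algebra_simps)
      moreover have "\<rho> n + poly (pderiv (h n)) (s n) = \<rho> n * poly (pderiv (G n)) ?z"
        by (simp add: h_def P_def pderiv_pcompose poly_pcompose pderiv_diff pderiv_pCons algebra_simps)
      ultimately show ?case
        by (simp add: q_def norm_mult mult.assoc mult.left_commute mult_left_mono)
    qed
  qed
  ultimately show False
    using s0(2) t0(2) LIMSEQ_unique by fastforce
qed

section \<open>Multipliers of fixed points and 2-cycles\<close>

text \<open>First-order expansion at the identity with increment \<open>F\<close>. Taking
  \<open>f - id\<close> and \<open>f \<circ> f - id\<close> as \<open>F\<close> yields explicit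
  cofactors below.\<close>

lemma pcompose_id_plus:
  fixes p F :: "'a :: idom poly"
  obtains U where "pcompose p ([:0, 1:] + F) = p + F * U"
    "\<And>z. poly F z = 0 \<Longrightarrow> poly U z = poly (pderiv p) z"
proof -
  have "\<exists>U. pcompose p ([:0, 1:] + F) = p + F * U \<and>
      (\<forall>z. poly F z = 0 \<longrightarrow> poly U z = poly (pderiv p) z)"
  proof (induction p)
    case (pCons a p)
    then obtain U where U: "pcompose p ([:0, 1:] + F) = p + F * U"
      "\<And>z. poly F z = 0 \<Longrightarrow> poly U z = poly (pderiv p) z" by blast
    have "pcompose (pCons a p) ([:0, 1:] + F) = [:a:] + ([:0, 1:] + F) * (p + F * U)"
      by (simp only: pcompose_pCons U(1))
    also have "\<dots> = ([:a:] + [:0, 1:] * p) + F * (p + ([:0, 1:] + F) * U)"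
      by (simp only: algebra_simps)
    also have "[:a:] + [:0, 1:] * p = pCons a p"
      by simp
    finally show ?case
      using U(2) by (intro exI[of _ "p + ([:0, 1:] + F) * U"]) (auto simp: pderiv_pCons)
  qed (auto intro: exI[of _ 0])
  then show thesis using that by blast
qed

lemma pcompose_power: "pcompose (p ^ n) q = pcompose p q ^ n"
  by (induction n) (simp_all add: pcompose_mult pcompose_1)

lemma pcompose_linear_factor:
  fixes q :: "'a :: comm_ring_1 poly"
  shows "pcompose [:- w, 1:] q = q - [:w:]"
  by (simp add: pcompose_pCons diff_conv_add_uminus add.commute del: add_uminus_conv_diff)

text \<open>Composition with \<open>q\<close> turns the linear factor at \<open>poly q z\<close>
  into \<open>q - [:poly q z:]\<close>, which vanishes at \<open>z\<close>.\<close>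

lemma order_le_order_pcompose:
  fixes p q :: "'a :: field poly"
  assumes "pcompose p q \<noteq> 0"
  shows "order (poly q z) p \<le> order z (pcompose p q)"
proof -
  let ?n = "order (poly q z) p"
  have "[:- poly q z, 1:] ^ ?n dvd p" by (rule order_1)
  then have "pcompose ([:- poly q z, 1:] ^ ?n) q dvd pcompose p q"
    by (metis dvdE dvdI pcompose_mult)
  moreover have "pcompose ([:- poly q z, 1:] ^ ?n) q = (q - [:poly q z:]) ^ ?n"
    by (simp add: pcompose_power pcompose_linear_factor)
  moreover have "[:- z, 1:] dvd q - [:poly q z:]"
    by (simp add: poly_eq_0_iff_dvd[symmetric])
  ultimately have "[:- z, 1:] ^ ?n dvd pcompose p q"
    by (metis dvd_power_same dvd_trans)
  then show ?thesis using assms by (simp add: order_divides)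
qed

text \<open>Pairs \<open>{x, i x}\<close> contribute twice \<open>n x\<close>; fixed points
  contribute an even number by assumption.\<close>

lemma even_sum_involution:
  fixes n :: "'a \<Rightarrow> nat"
  assumes "finite S" "\<And>x. x \<in> S \<Longrightarrow> i x \<in> S" "\<And>x. x \<in> S \<Longrightarrow> i (i x) = x"
    "\<And>x. x \<in> S \<Longrightarrow> n (i x) = n x" "\<And>x. x \<in> S \<Longrightarrow> i x = x \<Longrightarrow> even (n x)"
  shows "even (sum n S)"
  using assms
proof (induction S rule: finite_psubset_induct)
  case (psubset S)
  show ?case
  proof (cases "S = {}")
    case False
    then obtain x where x: "x \<in> S" by blast
    let ?T = "S - {x, i x}"
    have "even (sum n ?T)"
    proof (rule psubset.IH)
      show "i y \<in> ?T" if "y \<in> ?T" for y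
        using that x psubset.prems(1,2) by (metis Diff_iff insert_iff empty_iff)
    qed (use x psubset.prems in auto)
    moreover have "even (sum n {x, i x})"
      using x psubset.prems(3,4) by (cases "i x = x") auto
    moreover have "sum n S = sum n ?T + sum n {x, i x}"
      using x psubset.hyps psubset.prems(1) by (intro sum.subset_diff) auto
    ultimately show ?thesis by simp
  qed simp
qed

lemma ex_half_mset:
  assumes "\<And>x. even (count N x)"
  obtains N' where "N = N' + N'"
proof
  define N' where "N' = (\<Sum>x\<in>set_mset N. replicate_mset (count N x div 2) x)"
  have "count N' x = count N x div 2" for x
    by (auto simp: N'_def count_sum sum.delta' not_in_iff)
  then show "N = N' + N'"
    using assms by (intro multiset_eqI) (metis count_union dvd_div_mult_self mult_2_right)
qed

lemma proots_prod_linear [simp]: "proots (\<Prod>x\<in>#M. [:- (c x :: complex), 1:]) = image_mset c M"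
proof (induction M)
  case (add x M)
  have "(\<Prod>x\<in>#M. [:- c x, 1:]) \<noteq> 0" by (auto simp: prod_mset_zero_iff)
  with add show ?case by (simp add: proots_mult del: mult_pCons_left)
qed simp

lemma lead_coeff_prod_linear [simp]: "lead_coeff (\<Prod>x\<in>#M. [:- (c x :: complex), 1:]) = 1"
  by (induction M) (simp_all add: lead_coeff_mult del: mult_pCons_left)

text \<open>\<open>multiplier_poly\<close> is a definite description, so an explicit witness is
  required; for period \<open>1\<close> it is the defining product itself.\<close>

lemma fixed_multiplier_mem:
  assumes deg: "degree f \<ge> 2" and z: "poly f z = z"
  shows "poly (pderiv f) z \<in># multipliers f 1"
proof -
  let ?P = "f - [:0, 1:]"
  have it: "iter_poly f 1 = f" by (simp add: iter_poly_def)
  have "dynatomic f 1 = ?P"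
    by (rule dynatomic_eq_local[of _ _ "\<lambda>_. ?P"]) (use deg it in auto)
  then have "multiplier_poly f 1 = (\<Prod>z\<in>#proots ?P. [:- poly (pderiv f) z, 1:])"
    by (intro multiplier_poly_eq) (auto simp: it[simplified])
  moreover have "z \<in># proots ?P"
  proof -
    have "?P \<noteq> 0" using degree_minus_id[of f] deg by auto
    then show ?thesis using z by simp
  qed
  ultimately show ?thesis by (simp add: multipliers_def)
qed

text \<open>
  The multiplier polynomial has to be shown to exist: the involution \<open>f\<close> on the roots of \<open>\<Phi>\<close>
  preserves multipliers and orders, and at a fixed point of \<open>f\<close> with \<open>\<Phi> z = 0\<close>, where \<open>f' z = -1\<close>,
  comparing \<open>F \<circ> f = F * V\<close> to leading order shows that the order of \<open>F\<close> is odd.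
\<close>
lemma two_cycle_multiplier_mem:
  assumes deg: "degree f \<ge> 2" and z: "poly f (poly f z) = z" "poly f z \<noteq> z"
  shows "poly (pderiv f) (poly f z) * poly (pderiv f) z \<in># multipliers f 2"
proof -
  define P where "P = f - [:0, 1:]"
  define F where "F = iter_poly f 2 - [:0, 1:]"
  have it: "iter_poly f 1 = f" "iter_poly f 2 = pcompose f f"
    by (simp_all add: iter_poly_def numeral_2_eq_2)
  have F_eq: "F = pcompose f f - [:0, 1:]" by (simp add: F_def it)
  have P_F_nz: "P \<noteq> 0" "F \<noteq> 0"
    using iter_poly_minus_id_nonzero[of f 1] iter_poly_minus_id_nonzero[of f 2] deg it(1)
    by (auto simp: P_def F_def)
  obtain U where U: "pcompose f ([:0, 1:] + P) = f + P * U"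
    "\<And>z. poly P z = 0 \<Longrightarrow> poly U z = poly (pderiv f) z"
    using pcompose_id_plus by blast
  \<comment> \<open>The cofactor of \<open>P\<close> in \<open>F\<close>, which turns out to be the
    second dynatomic polynomial; at a fixed point \<open>z\<close> of \<open>f\<close> its value is
    \<open>1 + poly (pderiv f) z\<close>.\<close>
  define \<Phi> where "\<Phi> = 1 + U"
  have F_fac: "F = P * \<Phi>"
  proof -
    have "[:0, 1:] + P = f" by (simp add: P_def)
    with U(1) have "pcompose f f = f + P * U" by simp
    then have "F = f + P * U - [:0, 1:]" by (simp only: F_eq)
    also have "\<dots> = P + P * U" by (simp only: P_def diff_add_eq)
    finally show ?thesis by (simp only: \<Phi>_def distrib_left mult_1_right)
  qed
  have \<Phi>_nz: "\<Phi> \<noteq> 0" using P_F_nz F_fac by auto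
  obtain V where V: "pcompose f ([:0, 1:] + F) = f + F * V"
    "\<And>z. poly F z = 0 \<Longrightarrow> poly V z = poly (pderiv f) z"
    using pcompose_id_plus by blast
  \<comment> \<open>The third iterate is \<open>f + F \<circ> f\<close>, and also
    \<open>f \<circ> (id + F) = f + F * V\<close>.\<close>
  have F_V: "pcompose F f = F * V"
  proof -
    have "[:0, 1:] + F = pcompose f f" by (simp add: F_eq)
    with V(1) have "pcompose f (pcompose f f) = f + F * V" by simp
    then show ?thesis
      by (simp add: F_eq pcompose_diff pcompose_assoc pcompose_pCons)
  qed
  have F_f_nz: "pcompose F f \<noteq> 0"
    using P_F_nz(2) deg by (auto dest: pcompose_eq_0)
  have dyn: "dynatomic f 2 = \<Phi>"
  proof -
    have div2: "{k. k dvd (2::nat)} = {1, 2}"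
      using two_is_prime_nat unfolding prime_nat_iff by auto
    have "dynatomic f 2 = (if (2::nat) = 2 then \<Phi> else P)"
    proof (rule dynatomic_eq_local[OF deg, where \<Phi> = "\<lambda>k. if k = 2 then \<Phi> else P"])
      fix m :: nat assume "m dvd 2"
      then have "m = 1 \<or> m = 2" using div2 by blast
      then show "iter_poly f m - [:0, 1:] = (\<Prod>k | k dvd m. if k = 2 then \<Phi> else P)"
      proof
        assume "m = 1"
        then show ?thesis using it(1) by (simp add: P_def)
      next
        assume "m = 2"
        then show ?thesis using F_fac by (simp add: div2 F_def mult.commute)
      qed
    qed simp
    then show ?thesis by simp
  qed
  define \<mu> where "\<mu> z = poly (pderiv (iter_poly f 2)) z" for z
  have \<mu>: "\<mu> z = poly (pderiv f) (poly f z) * poly (pderiv f) z" for z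
    by (simp add: \<mu>_def it pderiv_pcompose poly_pcompose)
  have poly_F: "poly F z = poly f (poly f z) - z" for z
    by (simp add: F_eq poly_pcompose)
  have pderiv_F: "poly (pderiv F) z = \<mu> z - 1" for z
    by (simp add: F_def \<mu>_def pderiv_diff pderiv_pCons)
  have root: "poly f (poly f z) = z" if "poly \<Phi> z = 0" for z
    using that poly_F[of z] by (simp add: F_fac)
  have root_f: "poly \<Phi> (poly f z) = 0" if "poly \<Phi> z = 0" for z
  proof (cases "poly f z = z")
    case False
    then have "poly P (poly f z) \<noteq> 0" using root[OF that] by (simp add: P_def)
    moreover have "poly F (poly f z) = 0" using root[OF that] by (simp add: poly_F)
    ultimately show ?thesis by (simp add: F_fac)
  qed (use that in simp)
  have order_le: "order (poly f z) F \<le> order z F" if "poly F z = 0" "poly (pderiv f) z \<noteq> 0" for z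
  proof -
    have "order z (F * V) = order z F"
      using that V(2) F_f_nz F_V by (simp add: order_mult order_0I)
    then show ?thesis using order_le_order_pcompose[OF F_f_nz] F_V by metis
  qed
  have order_f: "order (poly f z) \<Phi> = order z \<Phi>" if "poly \<Phi> z = 0" for z
  proof (cases "poly f z = z")
    case False
    note ff = root[OF that]
    have ord: "order w \<Phi> = order w F" if "poly f w \<noteq> w" for w
      using that P_F_nz by (simp add: F_fac order_mult order_0I P_def)
    have F0: "poly F z = 0" "poly F (poly f z) = 0" using ff by (simp_all add: poly_F)
    \<comment> \<open>If \<open>\<mu> z = 0\<close>, both orders are \<open>1\<close>, as
      \<open>pderiv F\<close> equals \<open>-1\<close> along the cycle. Otherwise
      \<open>order_le\<close> applies at both points of the cycle.\<close>
    have "order (poly f z) F = order z F"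
    proof (cases "\<mu> z = 0")
      case True
      then have "\<mu> (poly f z) = 0" using ff by (auto simp: \<mu>)
      then have "poly (pderiv F) z \<noteq> 0" "poly (pderiv F) (poly f z) \<noteq> 0"
        using True by (simp_all add: pderiv_F)
      then show ?thesis
        using F0 P_F_nz by (simp add: order_pderiv order_0I)
    next
      case False
      then show ?thesis
        using order_le[OF F0(1)] order_le[OF F0(2)] ff by (simp add: \<mu>)
    qed
    then show ?thesis using ord[of z] ord[of "poly f z"] False ff by simp
  qed simp
  have order_even: "even (order z \<Phi>)" if "poly \<Phi> z = 0" "poly f z = z" for z
  proof -
    have P0: "poly P z = 0" using that by (simp add: P_def)
    \<comment> \<open>At a fixed point \<open>\<Phi>\<close> equals \<open>1 + f'\<close>, so the
      multiplier is \<open>-1\<close>, \<open>P\<close> has a simple root, and evenness for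
      \<open>\<Phi>\<close> amounts to oddness for \<open>F\<close>.\<close>
    then have f': "poly (pderiv f) z = - 1"
      using that U(2) by (simp add: \<Phi>_def add_eq_0_iff)
    have "poly (pderiv P) z \<noteq> 0" using f' by (simp add: P_def pderiv_diff pderiv_pCons)
    then have "order z P = 1"
      using P0 P_F_nz by (simp add: order_pderiv order_0I)
    then have ord: "order z F = Suc (order z \<Phi>)"
      using P_F_nz by (simp add: F_fac order_mult)
    define N where "N = order z F"
    obtain a where a: "F = [:- z, 1:] ^ N * a" "\<not> [:- z, 1:] dvd a"
      using order_decomp[OF P_F_nz(2)] unfolding N_def by blast
    have "[:- z, 1:] dvd f - [:z:]"
      using that by (simp add: poly_eq_0_iff_dvd[symmetric])
    then obtain b where b: "f - [:z:] = [:- z, 1:] * b" by (rule dvdE)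
    have "pderiv (f - [:z:]) = pderiv ([:- z, 1:] * b)" by (simp only: b)
    then have "poly (pderiv f) z = poly b z"
      by (simp add: pderiv_diff pderiv_mult pderiv_pCons pderiv_smult)
    then have bz: "poly b z = - 1" using f' by simp
    have "pcompose F f = (f - [:z:]) ^ N * pcompose a f"
    proof -
      have "pcompose ([:- z, 1:] ^ N) f = (f - [:z:]) ^ N"
        by (simp add: pcompose_power pcompose_linear_factor)
      then show ?thesis by (simp add: a(1) pcompose_mult)
    qed
    \<comment> \<open>Cancelling the \<open>N\<close>-fold root and evaluating at \<open>z\<close>,
      where \<open>b\<close> and \<open>V\<close> both equal \<open>-1\<close>, leaves
      \<open>(- 1) ^ N = - 1\<close>.\<close>
    then have "[:- z, 1:] ^ N * (b ^ N * pcompose a f) = [:- z, 1:] ^ N * (a * V)"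
      using F_V by (simp only: a(1) b power_mult_distrib mult.assoc)
    then have "b ^ N * pcompose a f = a * V" by simp
    then have "poly (b ^ N * pcompose a f) z = poly (a * V) z" by simp
    moreover have "poly V z = - 1" using V(2) f' that by (simp add: poly_F)
    ultimately have "(- 1) ^ N * poly a z = - poly a z"
      using that bz by (simp add: poly_pcompose)
    moreover have "poly a z \<noteq> 0" using a(2) by (simp add: poly_eq_0_iff_dvd)
    ultimately have "odd N" by (cases "even N") auto
    then show ?thesis using ord by (simp add: N_def)
  qed
  define M where "M = image_mset \<mu> (proots \<Phi>)"
  \<comment> \<open>\<open>f\<close> is an involution on the roots of \<open>\<Phi>\<close> with
    multiplier \<open>l\<close> and preserves their orders, and roots it fixes have even order;
    hence the product over all roots is a square.\<close>
  have "even (count M l)" for l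
  proof -
    have "count M l = (\<Sum>z | poly \<Phi> z = 0 \<and> \<mu> z = l. order z \<Phi>)"
      using \<Phi>_nz by (simp add: M_def count_image_mset' eq_commute[of l])
    moreover have "even (\<Sum>z | poly \<Phi> z = 0 \<and> \<mu> z = l. order z \<Phi>)"
    proof (rule even_sum_involution[of _ "poly f"])
      show "finite {z. poly \<Phi> z = 0 \<and> \<mu> z = l}"
        using poly_roots_finite[OF \<Phi>_nz] by (rule rev_finite_subset) auto
    qed (use root root_f order_f order_even in \<open>auto simp: \<mu>\<close>)
    ultimately show ?thesis by simp
  qed
  then obtain N where N: "M = N + N" using ex_half_mset by blast
  have "multiplier_poly f 2 = (\<Prod>x\<in>#N. [:- x, 1:])"
  proof (rule multiplier_poly_eq)
    have "(\<Prod>x\<in>#N. [:- x, 1:]) ^ 2 = (\<Prod>x\<in>#M. [:- x, 1:])"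
      by (simp add: N power2_eq_square)
    also have "\<dots> = (\<Prod>z\<in>#proots \<Phi>. [:- \<mu> z, 1:])"
      by (simp add: M_def image_mset.compositionality o_def)
    finally show "(\<Prod>x\<in>#N. [:- x, 1:]) ^ 2
        = (\<Prod>z\<in>#proots (dynatomic f 2). [:- poly (pderiv (iter_poly f 2)) z, 1:])"
      by (simp add: dyn \<mu>_def)
  qed simp_all
  then have "multipliers f 2 = N" by (simp add: multipliers_def)
  moreover have "\<mu> z \<in># M"
  proof -
    have "poly P z \<noteq> 0" "poly F z = 0" using z by (simp_all add: P_def poly_F)
    then have "poly \<Phi> z = 0" by (simp add: F_fac)
    then show ?thesis using \<Phi>_nz by (simp add: M_def)
  qed
  ultimately show ?thesis using N by (auto simp: \<mu>)
qed

lemma le_max_log_multiplier: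
  assumes "l \<in># multipliers f p"
  shows "ereal (1 / real p) * log_abs l \<le> max_log_multiplier f p"
  unfolding max_log_multiplier_def using assms by (intro Max_ge) auto

text \<open>The lower bound forces \<open>l \<noteq> 0\<close>, which avoids the value
  \<open>-\<infinity>\<close> of \<open>log_abs\<close>; the factor \<open>p\<close> undoes the
  normalisation by \<open>1 / p\<close>.\<close>

lemma less_max_log_multiplier:
  assumes "l \<in># multipliers f p" "p \<ge> 1" "exp (real p * r) < cmod l"
  shows "ereal r < max_log_multiplier f p"
proof -
  have pos: "0 < cmod l" using assms(3) exp_gt_zero less_trans by blast
  then have "real p * r < ln (cmod l)" using assms(3) ln_less_cancel_iff[of "exp (real p * r)" "cmod l"] by simp
  then have "r < 1 / real p * ln (cmod l)" using assms(2) by (simp add: field_simps)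
  then have "ereal r < ereal (1 / real p) * log_abs l"
    using pos by (simp add: log_abs_def)
  also have "\<dots> \<le> max_log_multiplier f p" by (rule le_max_log_multiplier[OF assms(1)])
  finally show ?thesis .
qed

section \<open>Affine conjugation and compactness\<close>

lemma poly_aff_conj: "poly (aff_conj a b f) z = b + a * poly f ((z - b) / a)"
  by (simp add: aff_conj_def poly_pcompose diff_divide_distrib mult.commute)

lemma poly_pderiv_aff_conj:
  "a \<noteq> 0 \<Longrightarrow> poly (pderiv (aff_conj a b f)) z = poly (pderiv f) ((z - b) / a)"
  by (simp add: aff_conj_def pderiv_pcompose poly_pcompose pderiv_pCons diff_divide_distrib)

lemma degree_aff_conj: "a \<noteq> 0 \<Longrightarrow> degree (aff_conj a b f) = degree f"
  by (simp add: aff_conj_def degree_pcompose)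

text \<open>The outer map contributes \<open>a\<close>, the inner one \<open>1 / a\<close> to the
  power of the degree. The formula serves both to make \<open>f\<close> monic and to bound distances
  of fixed points.\<close>

lemma lead_coeff_aff_conj:
  assumes "a \<noteq> 0" "degree f > 0"
  shows "lead_coeff (aff_conj a b f) = lead_coeff f / a ^ (degree f - 1)"
proof -
  have "lead_coeff (aff_conj a b f) = a * (lead_coeff f * (1 / a) ^ degree f)"
    using assms unfolding aff_conj_def by (subst lead_coeff_comp, simp add: degree_pcompose, subst lead_coeff_comp, simp_all)
  also have "\<dots> = lead_coeff f / a ^ (degree f - 1)"
    using assms by (cases "degree f") (simp_all add: power_one_over field_simps)
  finally show ?thesis .
qed

lemma fixed_bound_aff_conj:
  assumes "a \<noteq> 0" "fixed_bound R f"
  shows "fixed_bound R (aff_conj a b f)"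
  unfolding fixed_bound_def
proof (intro allI impI)
  fix z assume "poly (aff_conj a b f) z = z"
  then have "poly f ((z - b) / a) = (z - b) / a"
    using assms(1) by (simp add: poly_aff_conj field_simps)
  then show "cmod (poly (pderiv (aff_conj a b f)) z) \<le> R"
    using assms by (simp add: poly_pderiv_aff_conj fixed_bound_def)
qed

lemma two_cycle_bound_aff_conj:
  assumes "a \<noteq> 0" "two_cycle_bound R f"
  shows "two_cycle_bound R (aff_conj a b f)"
  unfolding two_cycle_bound_def
proof (intro allI impI)
  fix z
  let ?g = "aff_conj a b f" and ?w = "(z - b) / a"
  assume z: "poly ?g (poly ?g z) = z" "poly ?g z \<noteq> z"
  have w: "(poly ?g z - b) / a = poly f ?w"
    using assms(1) by (simp add: poly_aff_conj)
  have "poly f (poly f ?w) = ?w"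
    using z(1) assms(1) w poly_aff_conj[of a b f "poly ?g z"] by (simp add: field_simps)
  moreover have "poly f ?w \<noteq> ?w"
    using z(2) assms(1) by (simp add: poly_aff_conj field_simps)
  ultimately have "cmod (poly (pderiv f) (poly f ?w) * poly (pderiv f) ?w) \<le> R"
    using assms(2) unfolding two_cycle_bound_def by blast
  then show "cmod (poly (pderiv ?g) (poly ?g z) * poly (pderiv ?g) z) \<le> R"
    using assms(1) w by (simp add: poly_pderiv_aff_conj)
qed

section \<open>Compact sets of polynomials and of conjugacy classes\<close>

lemma compactin_monic_bounded:
  "compactin (Poly_top d) {g. degree g = d \<and> lead_coeff g = 1 \<and> (\<forall>i<d. cmod (coeff g i) \<le> B)}"
    (is "compactin _ ?K")
proof -
  \<comment> \<open>The coefficient functions form a product of discs and single points, compact by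
    Tychonoff; the value \<open>1\<close> at index \<open>d\<close> keeps the degree from
    dropping.\<close>
  define C where
    "C = PiE UNIV (\<lambda>i. if i < d then cball 0 B else if i = d then {1} else {0 :: complex})"
  have C_props: "c d = 1" "\<And>i. i > d \<Longrightarrow> c i = 0" "\<And>i. i < d \<Longrightarrow> cmod (c i) \<le> B" if "c \<in> C" for c
  proof -
    have mem: "c i \<in> (if i < d then cball 0 B else if i = d then {1} else {0})" for i
      using that unfolding C_def by (rule PiE_mem) simp
    show "c d = 1" using mem[of d] by simp
    show "c i = 0" if "i > d" for i using mem[of i] that by simp
    show "cmod (c i) \<le> B" if "i < d" for i using mem[of i] that by simp
  qed
  have coeff_C: "coeff (Abs_poly c) = c" if "c \<in> C" for c
    using C_props(2)[OF that] by (rule coeff_Abs_poly)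
  have deg: "degree (Abs_poly c) = d" if "c \<in> C" for c
    using C_props[OF that] coeff_C[OF that]
    by (intro antisym degree_le le_degree) auto
  have "compactin (subtopology euclidean C) C"
    using compactin_PiE[of "\<lambda>_. euclidean" UNIV
        "\<lambda>i. if i < d then cball 0 B else if i = d then {1} else {0 :: complex}"]
    by (auto simp: C_def euclidean_product_topology compactin_subtopology)
  moreover have "continuous_map (subtopology euclidean C) (Poly_top d) Abs_poly"
    unfolding Poly_top_def
  proof (rule continuous_map_pullback')
    have "continuous_map (subtopology euclidean C) euclidean (\<lambda>c. c)"
      by simp
    then show "continuous_map (subtopology euclidean C) euclidean (coeff \<circ> Abs_poly)"
      by (rule continuous_map_eq) (simp add: coeff_C)
    show "topspace (subtopology euclidean C) \<subseteq> Abs_poly -` Poly_deg d"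
      using deg by (auto simp: Poly_deg_def)
  qed
  ultimately have "compactin (Poly_top d) (Abs_poly ` C)"
    by (rule image_compactin)
  moreover have "Abs_poly ` C = ?K"
  proof (intro equalityI subsetI)
    fix g assume "g \<in> ?K"
    then have "coeff g \<in> C"
      by (auto simp: C_def PiE_def Pi_def coeff_eq_0)
    moreover have "g = Abs_poly (coeff g)" by (simp add: coeff_inverse)
    ultimately show "g \<in> Abs_poly ` C" by blast
  qed (use deg coeff_C C_props in auto)
  ultimately show ?thesis by simp
qed

text \<open>Each linear factor multiplies the bound by at most \<open>1 + B\<close>.\<close>

lemma norm_coeff_prod_linear_le:
  assumes "\<And>x. x \<in># M \<Longrightarrow> cmod x \<le> B" "B \<ge> 0"
  shows "cmod (coeff (\<Prod>x\<in>#M. [:- x, 1:]) i) \<le> (1 + B) ^ size M"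
  using assms(1)
proof (induction M arbitrary: i)
  case empty
  then show ?case by (cases i) auto
next
  case (add x M)
  let ?p = "\<Prod>x\<in>#M. [:- x, 1:]"
  have p: "cmod (coeff ?p j) \<le> (1 + B) ^ size M" for j
    using add by simp
  have b: "cmod (coeff (pCons 0 ?p) i) \<le> (1 + B) ^ size M"
    using p assms(2) by (cases i) auto
  have b': "cmod (x * coeff ?p i) \<le> B * (1 + B) ^ size M"
    unfolding norm_mult using add.prems p assms(2) by (intro mult_mono) auto
  have "coeff ([:- x, 1:] * ?p) i = coeff (pCons 0 ?p) i - x * coeff ?p i"
    by simp
  then have "cmod (coeff ([:- x, 1:] * ?p) i) \<le> (1 + B) ^ size M + B * (1 + B) ^ size M"
    using b b' norm_triangle_ineq4[of "coeff (pCons 0 ?p) i" "x * coeff ?p i"] by simp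
  moreover have "(\<Prod>x\<in>#add_mset x M. [:- x, 1:]) = [:- x, 1:] * ?p"
    by (simp only: image_mset_add_mset prod_mset.add_mset)
  ultimately show ?case by (simp add: distrib_right)
qed

lemma ex_fixed_point:
  fixes f :: "complex poly"
  assumes "degree f \<ge> 2"
  shows "\<exists>z. poly f z = z"
proof -
  have "\<not> constant (poly (f - [:0, 1:]))"
    using assms degree_minus_id[OF assms] by (simp add: constant_degree)
  from Fundamental_Theorem_Algebra.fundamental_theorem_of_algebra[OF this] show ?thesis by auto
qed

text \<open>Dilation by a root of order \<open>degree f - 1\<close> of the leading coefficient makes
  \<open>f\<close> monic, and a translation puts a fixed point at \<open>0\<close>.\<close>

lemma ex_monic_conjugate:
  assumes d: "degree f \<ge> 2"
  obtains a b where "a \<noteq> 0" "lead_coeff (aff_conj a b f) = 1" "poly (aff_conj a b f) 0 = 0"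
proof -
  obtain z where z: "poly f z = z" using ex_fixed_point[OF d] by blast
  have "degree f - 1 \<noteq> 0" using d by simp
  then obtain a where a: "lead_coeff f = a ^ (degree f - 1)"
    using exists_complex_root by metis
  have lc: "lead_coeff f \<noteq> 0" using d by auto
  have "a \<noteq> 0"
  proof
    assume "a = 0"
    then show False using a lc \<open>degree f - 1 \<noteq> 0\<close> by (simp add: power_0_left)
  qed
  show thesis
  proof
    show "a \<noteq> 0" by fact
    show "lead_coeff (aff_conj a (- a * z) f) = 1"
      using \<open>a \<noteq> 0\<close> d a lc by (simp add: lead_coeff_aff_conj)
    show "poly (aff_conj a (- a * z) f) 0 = 0"
      using \<open>a \<noteq> 0\<close> z by (simp add: poly_aff_conj)
  qed
qed

text \<open>
  If a conjugation invariant property bounds the leading coefficient once two fixed points are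
  moved to \<open>0\<close> and \<open>1\<close>, then the monic conjugates with fixed point \<open>0\<close> of the polynomials with this
  property have bounded fixed points, hence bounded coefficients.
\<close>
lemma degenerates_imp_eventually_not:
  assumes d: "d \<ge> 2" and f: "\<And>n. f n \<in> Poly_deg d" and degen: "degenerates d f"
    and inv: "\<And>a b g. a \<noteq> 0 \<Longrightarrow> Q g \<Longrightarrow> Q (aff_conj a b g)"
    and bound: "\<And>g. degree g = d \<Longrightarrow> poly g 0 = 0 \<Longrightarrow> poly g 1 = 1 \<Longrightarrow> Q g \<Longrightarrow> cmod (lead_coeff g) \<le> B"
  shows "\<forall>\<^sub>F n in sequentially. \<not> Q (f n)"
proof -
  define B' where "B' = max 1 B"
  \<comment> \<open>Dilation by \<open>1 / z\<close> moves the fixed point to \<open>1\<close> and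
    turns the leading coefficient into \<open>z ^ (d - 1)\<close>, which \<open>bound\<close>
    controls; \<open>d \<ge> 2\<close> makes the exponent at least \<open>1\<close>.\<close>
  have fp: "cmod z \<le> B'"
    if g: "degree g = d" "lead_coeff g = 1" "poly g 0 = 0" "Q g" and z: "poly g z = z" for g z
  proof (cases "cmod z \<le> 1")
    case False
    then have nz: "1 / z \<noteq> 0" by auto
    let ?g = "aff_conj (1 / z) 0 g"
    have "lead_coeff ?g = z ^ (d - 1)"
      using lead_coeff_aff_conj[OF nz, of g 0] g(1,2) d by (simp add: power_one_over)
    moreover have "cmod (lead_coeff ?g) \<le> B"
      using False z g(1,3,4) nz by (intro bound inv) (auto simp: degree_aff_conj poly_aff_conj)
    ultimately have "cmod z ^ (d - 1) \<le> B" by (simp add: norm_power)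
    moreover have "cmod z ^ 1 \<le> cmod z ^ (d - 1)"
      using False d by (intro power_increasing) auto
    ultimately show ?thesis by (simp add: B'_def)
  qed (simp add: B'_def)
  \<comment> \<open>The fixed points are the roots of the monic polynomial
    \<open>g - [:0, 1:]\<close>, whose coefficients have modulus at most
    \<open>(1 + B') ^ d\<close>; the summand \<open>1\<close> pays for the identity.\<close>
  define K where "K = {g. degree g = d \<and> lead_coeff g = 1 \<and> (\<forall>i<d. cmod (coeff g i) \<le> 1 + (1 + B') ^ d)}"
  have K: "g \<in> K" if g: "degree g = d" "lead_coeff g = 1" "poly g 0 = 0" "Q g" for g
  proof -
    let ?P = "g - [:0, 1:]"
    note P = degree_minus_id[of g, unfolded g(1), OF d]
    have P_eq: "(\<Prod>x\<in>#proots ?P. [:- x, 1:]) = ?P"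
      using complex_poly_decompose_multiset[of ?P] P g(1,2) by simp
    have "cmod (coeff g i) \<le> 1 + (1 + B') ^ d" for i
    proof -
      have "cmod (coeff (\<Prod>x\<in>#proots ?P. [:- x, 1:]) i) \<le> (1 + B') ^ size (proots ?P)"
      proof (rule norm_coeff_prod_linear_le)
        fix x assume "x \<in># proots ?P"
        moreover have "?P \<noteq> 0" using P(1) d by auto
        ultimately show "cmod x \<le> B'" using fp[OF g] by simp
      qed (simp add: B'_def)
      then have "cmod (coeff ?P i) \<le> (1 + B') ^ d"
        unfolding P_eq using P by (simp add: size_proots_complex)
      moreover have "cmod (coeff [:0, 1 :: complex:] i) \<le> 1"
        by (auto simp: coeff_pCons split: nat.splits)
      moreover have "coeff g i = coeff [:0, 1:] i + coeff ?P i" by simp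
      ultimately show ?thesis by (metis add_mono norm_triangle_ineq order_trans)
    qed
    then show ?thesis using g by (simp add: K_def)
  qed
  have "compactin (Moduli_top d) (aff_class ` K)"
    unfolding K_def
    by (rule image_compactin[OF compactin_monic_bounded quotient_imp_continuous_map[OF quotient_map_aff_class]])
  then have "\<forall>\<^sub>F n in sequentially. aff_class (f n) \<notin> aff_class ` K"
    using degen by (simp add: degenerates_def)
  then show ?thesis
  proof (rule eventually_mono, intro notI)
    fix n assume n: "aff_class (f n) \<notin> aff_class ` K" and "Q (f n)"
    have deg: "degree (f n) = d" using f[of n] by (simp add: Poly_deg_def)
    obtain a b where ab: "a \<noteq> 0" "lead_coeff (aff_conj a b (f n)) = 1" "poly (aff_conj a b (f n)) 0 = 0"
      using ex_monic_conjugate[of "f n"] deg d by blast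
    have "aff_conj a b (f n) \<in> K"
      using ab deg \<open>Q (f n)\<close> by (intro K inv) (auto simp: degree_aff_conj)
    moreover have "aff_class (f n) = aff_class (aff_conj a b (f n))"
      using ab(1) by (auto simp: aff_class_eq_iff)
    ultimately show False using n by blast
  qed
qed

section \<open>Bounds on the leading coefficient\<close>

lemma ex_lead_coeff_bound:
  assumes "d \<ge> 2"
  shows "\<exists>B. \<forall>g. degree g = d \<longrightarrow> poly g 0 = 0 \<longrightarrow> poly g 1 = 1 \<longrightarrow>
           fixed_bound R g \<and> two_cycle_bound R g \<longrightarrow> cmod (lead_coeff g) \<le> B"
proof (rule ccontr)
  assume "\<not> ?thesis"
  \<comment> \<open>No explicit bound is produced: polynomials exceeding every \<open>n\<close>
    would form a sequence that \<open>no_bounded_blowup\<close> excludes.\<close>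
  then have "\<forall>n::nat. \<exists>g. degree g = d \<and> poly g 0 = 0 \<and> poly g 1 = 1 \<and>
           fixed_bound R g \<and> two_cycle_bound R g \<and> cmod (lead_coeff g) > real n"
    by (meson not_le)
  then obtain g where g: "\<And>n::nat. degree (g n) = d" "\<And>n. poly (g n) 0 = 0" "\<And>n. poly (g n) 1 = 1"
    "\<And>n. fixed_bound R (g n)" "\<And>n. two_cycle_bound R (g n)" "\<And>n. cmod (lead_coeff (g n)) > real n"
    by metis
  have "filterlim (\<lambda>n. cmod (lead_coeff (g n))) at_top sequentially"
    by (rule filterlim_at_top_mono[OF filterlim_real_sequentially]) (use g(6) in \<open>simp add: less_imp_le\<close>)
  then show False by (rule no_bounded_blowup[OF assms g(1-3) _ g(4,5)])
qed

text \<open>Here \<open>g - id\<close> is \<open>z * (z - 1) * Q\<close> with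
  \<open>degree Q \<le> 1\<close>. Its derivatives at \<open>0\<close> and \<open>1\<close> are
  \<open>- Q 0\<close> and \<open>Q 1\<close>, and these two values determine
  \<open>Q\<close>.\<close>

lemma lead_coeff_bound_low_degree:
  assumes d: "degree g \<in> {2, 3}" and fp: "poly g 0 = 0" "poly g 1 = 1" and R: "fixed_bound R g"
  shows "cmod (lead_coeff g) \<le> 2 * (R + 1)"
proof -
  let ?P = "g - [:0, 1:]"
  have deg: "degree ?P = degree g" "lead_coeff ?P = lead_coeff g"
    by (rule degree_minus_id; use d in auto)+
  have g': "cmod (poly (pderiv g) 0) \<le> R" "cmod (poly (pderiv g) 1) \<le> R"
    using R fp by (auto simp: fixed_bound_def)
  then have P': "cmod (poly (pderiv ?P) 0) \<le> R + 1" "cmod (poly (pderiv ?P) 1) \<le> R + 1"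
    using norm_triangle_ineq4[of "poly (pderiv g) 0" 1] norm_triangle_ineq4[of "poly (pderiv g) 1" 1]
    by (auto simp: pderiv_diff pderiv_pCons)
  have "[:0, 1:] dvd ?P" using poly_eq_0_iff_dvd[of ?P 0] fp by simp
  then obtain Q1 where Q1: "?P = [:0, 1:] * Q1" by (rule dvdE)
  have "poly ?P 1 = 0" using fp by simp
  then have "poly Q1 1 = 0" unfolding Q1 by simp
  then obtain Q where Q: "Q1 = [:-1, 1:] * Q"
    unfolding poly_eq_0_iff_dvd by (rule dvdE)
  have P_eq: "?P = [:0, -1, 1:] * Q" unfolding Q1 Q by simp
  have nz: "Q \<noteq> 0" using P_eq deg d by auto
  have "degree ?P = 2 + degree Q"
    unfolding P_eq using nz by (simp add: degree_mult_eq del: mult_pCons_left)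
  moreover have "lead_coeff ?P = lead_coeff Q"
    unfolding P_eq by (simp only: lead_coeff_mult) simp
  ultimately have Q_deg: "degree Q \<le> 1" "lead_coeff g = lead_coeff Q"
    using d deg by auto
  have "poly (pderiv ?P) 0 = - poly Q 0" "poly (pderiv ?P) 1 = poly Q 1"
    unfolding P_eq by (simp_all add: pderiv_mult pderiv_pCons del: mult_pCons_left)
  then have b: "cmod (poly Q 0) \<le> R + 1" "cmod (poly Q 1) \<le> R + 1" using P' by auto
  show ?thesis
  proof (cases "degree Q = 0")
    case True
    then have "lead_coeff Q = poly Q 0" by (simp add: poly_0_coeff_0)
    then show ?thesis using b Q_deg order_trans[OF norm_ge_zero b(1)] by simp
  next
    case False
    then have "degree Q = 1" using Q_deg by simp
    then have "Q = [:coeff Q 0, coeff Q 1:]" "lead_coeff Q = coeff Q 1"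
      by (auto intro!: poly_eqI simp: coeff_pCons coeff_eq_0 split: nat.splits)
    then have "lead_coeff Q = poly Q 1 - poly Q 0"
      by (metis add_diff_cancel_left' mult.commute mult.left_neutral mult_zero_left poly_0 poly_pCons add.right_neutral)
    then show ?thesis
      using b Q_deg norm_triangle_ineq4[of "poly Q 1" "poly Q 0"] by simp
  qed
qed

section \<open>Divergence of the maximal multipliers\<close>

lemma exceeds_of_unbounded_fixed:
  assumes "degree f \<ge> 2" "\<not> fixed_bound (exp r) f"
  shows "ereal r < max_log_multiplier f 1"
  using assms fixed_multiplier_mem[OF assms(1)] less_max_log_multiplier[of _ f 1 r]
  by (auto simp: fixed_bound_def not_le)

lemma exceeds_of_unbounded_two_cycle:
  assumes "degree f \<ge> 2" "\<not> two_cycle_bound (exp (2 * r)) f"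
  shows "ereal r < max_log_multiplier f 2"
  using assms two_cycle_multiplier_mem[OF assms(1)] less_max_log_multiplier[of _ f 2 r]
  by (auto simp: two_cycle_bound_def not_le)

lemma fixed_bound_mono: "fixed_bound R f \<Longrightarrow> R \<le> R' \<Longrightarrow> fixed_bound R' f"
  unfolding fixed_bound_def by (meson order_trans)

lemma two_cycle_bound_mono: "two_cycle_bound R f \<Longrightarrow> R \<le> R' \<Longrightarrow> two_cycle_bound R' f"
  unfolding two_cycle_bound_def by (meson order_trans)

theorem theorem1:
  fixes d :: nat and f :: "nat \<Rightarrow> complex poly"
  assumes "d \<ge> 2"
    and "\<And>n. f n \<in> Poly_deg d"
    and "degenerates d f"
  shows "((\<lambda>n. max (max_log_multiplier (f n) 1) (max_log_multiplier (f n) 2))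
            \<longlongrightarrow> (\<infinity>::ereal)) sequentially \<and>
         (d \<in> {2, 3} \<longrightarrow>
            ((\<lambda>n. max_log_multiplier (f n) 1) \<longlongrightarrow> (\<infinity>::ereal)) sequentially)"
proof (intro conjI impI)
  have deg: "degree (f n) \<ge> 2" for n using assms(1,2) by (simp add: Poly_deg_def)
  show "(\<lambda>n. max (max_log_multiplier (f n) 1) (max_log_multiplier (f n) 2)) \<longlonglongrightarrow> \<infinity>"
    unfolding tendsto_PInfty
  proof
    fix r :: real
    \<comment> \<open>One constant has to serve both bounds; the exponent \<open>2 * r\<close>
      reflects the factor \<open>1 / 2\<close> in period \<open>2\<close>.\<close>
    define R where "R = max (exp r) (exp (2 * r))"
    obtain B where B: "\<And>g. degree g = d \<Longrightarrow> poly g 0 = 0 \<Longrightarrow> poly g 1 = 1 \<Longrightarrow>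
        fixed_bound R g \<and> two_cycle_bound R g \<Longrightarrow> cmod (lead_coeff g) \<le> B"
      using ex_lead_coeff_bound[OF assms(1), of R] by blast
    have "\<forall>\<^sub>F n in sequentially. \<not> (fixed_bound R (f n) \<and> two_cycle_bound R (f n))"
      by (rule degenerates_imp_eventually_not[OF assms _ B])
        (auto intro: fixed_bound_aff_conj two_cycle_bound_aff_conj)
    then show "\<forall>\<^sub>F n in sequentially. ereal r < max (max_log_multiplier (f n) 1) (max_log_multiplier (f n) 2)"
    proof eventually_elim
      case (elim n)
      then have "\<not> fixed_bound (exp r) (f n) \<or> \<not> two_cycle_bound (exp (2 * r)) (f n)"
        using fixed_bound_mono[of "exp r" _ R] two_cycle_bound_mono[of "exp (2 * r)" _ R] by (auto simp: R_def)
      then show ?case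
        using exceeds_of_unbounded_fixed[OF deg] exceeds_of_unbounded_two_cycle[OF deg]
        by (auto simp: less_max_iff_disj)
    qed
  qed
  assume d: "d \<in> {2, 3}"
  show "(\<lambda>n. max_log_multiplier (f n) 1) \<longlonglongrightarrow> \<infinity>"
    unfolding tendsto_PInfty
  proof
    fix r :: real
    have "\<forall>\<^sub>F n in sequentially. \<not> fixed_bound (exp r) (f n)"
      using d by (intro degenerates_imp_eventually_not[OF assms, where B = "2 * (exp r + 1)"]
          fixed_bound_aff_conj lead_coeff_bound_low_degree) auto
    then show "\<forall>\<^sub>F n in sequentially. ereal r < max_log_multiplier (f n) 1"
      by eventually_elim (rule exceeds_of_unbounded_fixed[OF deg])
  qed
qed

end
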